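(* Let $\mathcal{G}$ be a finite simple connected graph with at least two vertices. There exist constants $\beta_+>0$ and $\beta_->0$, depending only on $\mathcal{G}$, such that the mixing time of the Attracting Random Walks (ARW) chain with $n$ particles on $\mathcal{G}$ is $\exp(\Omega(n))$ for every fixed $\beta>\beta_+$ and $O(n\log n)$ for every fixed $0\le\beta<\beta_-$, and such that the Cheeger constant $\Phi_*$ of the ARW chain satisfies, as $n\to\infty$: (i) if $0\le\beta<\beta_-$, then $\Phi_*=\frac{1}{O(n\log n)}$, i.e. there are $c>0$, $n_0$ with $\Phi_*\ge\frac{c}{n\log n}$ for all $n\ge n_0$; (ii) if $\beta>\beta_+$, then $\Phi_*=\exp(-\Omega(n))$, i.e. there are $c>0$, $n_0$ with $\Phi_*\le e^{-cn}$ for all $n\ge n_0$. (Constants $c,n_0$ may depend on $\mathcal{G}$ and $\beta$.)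
   Context: ARW chain: let $\mathcal{G}=(\mathcal{V},\mathcal{E})$ be a finite simple connected graph with $k=|\mathcal{V}|$ vertices; write $i\sim j$ if $(i,j)\in\mathcal{E}$. For $n\ge1$ the state space is $\Omega=\{x\in\mathbb{Z}_{\ge0}^{\mathcal{V}}:\sum_i x(i)=n\}$ ($x(i)$ is the number of indistinguishable particles at vertex $i$). For $\beta\in\mathbb{R}$, one step from $x$ is: choose one of the $n$ particles uniformly at random, say located at $i$; move it to a neighbor $j\sim i$ with probability $\frac1Z\exp(\frac{\beta}{n}x(j))$, or keep it at $i$ with probability $\frac1Z\exp(\frac{\beta}{n}(x(i)-1))$, where $Z=\sum_{l\sim i}\exp(\frac{\beta}{n}x(l))+\exp(\frac{\beta}{n}(x(i)-1))$. Let $P$ be the transition matrix and $\pi$ the stationary distribution. Mixing time: $d(X,t)=\max_{x\in\Omega}\|P^t(x,\cdot)-\pi\|_{\mathrm{TV}}$, $t_{\mathrm{mix}}(X,\epsilon)=\min\{t: d(X,t)\le\epsilon\}$; "the mixing time" means $t_{\mathrm{mix}}(X,1/4)$. Cheeger constant: for an irreducible aperiodic chain with transition matrix $P$ and stationary distribution $\pi$ on $\Omega$, let $Q(x,y)=\pi(x)P(x,y)$, $Q(A,B)=\sum_{x\in A,y\in B}Q(x,y)$, $\Phi(S)=Q(S,S^c)/\pi(S)$ for nonempty $S\subset\Omega$, and $\Phi_*=\min_{S\ne\emptyset:\,\pi(S)\le1/2}\Phi(S)$. The graph and $\beta$ are fixed while $n\to\infty$. *)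

theory Defs
  imports "HOL-Probability.Probability" "HOL-Library.Landau_Symbols"
    "Graph_Theory.Graph_Theory"
begin

section \<open>Finite Markov chains\<close>

text \<open>
  A chain on a finite state space \<open>\<Omega>\<close> is given by its kernel \<open>K\<close>; the transition
  matrix is \<open>P x y = pmf (K x) y\<close>.  The kernel may be defined (arbitrarily) outside \<open>\<Omega>\<close>.
\<close>

definition chain_dist :: "('s \<Rightarrow> 's pmf) \<Rightarrow> nat \<Rightarrow> 's \<Rightarrow> 's pmf" where
  "chain_dist K t x = ((\<lambda>\<mu>. bind_pmf \<mu> K) ^^ t) (return_pmf x)"

definition stationary_on :: "'s set \<Rightarrow> ('s \<Rightarrow> 's pmf) \<Rightarrow> 's pmf \<Rightarrow> bool" where
  "stationary_on \<Omega> K \<pi> \<longleftrightarrow> set_pmf \<pi> \<subseteq> \<Omega> \<and> bind_pmf \<pi> K = \<pi>"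

text \<open>Meaningful when the chain is irreducible on \<open>\<Omega>\<close>, so that \<open>\<pi>\<close> exists and is unique.\<close>

definition stationary_pmf :: "'s set \<Rightarrow> ('s \<Rightarrow> 's pmf) \<Rightarrow> 's pmf" where
  "stationary_pmf \<Omega> K = (THE \<pi>. stationary_on \<Omega> K \<pi>)"

definition tv_dist :: "'s pmf \<Rightarrow> 's pmf \<Rightarrow> real" where
  "tv_dist \<mu> \<nu> = (SUP A. \<bar>measure_pmf.prob \<mu> A - measure_pmf.prob \<nu> A\<bar>)"

definition mixing_dist :: "'s set \<Rightarrow> ('s \<Rightarrow> 's pmf) \<Rightarrow> nat \<Rightarrow> real" where
  "mixing_dist \<Omega> K t = (MAX x\<in>\<Omega>. tv_dist (chain_dist K t x) (stationary_pmf \<Omega> K))"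

definition mixing_time :: "'s set \<Rightarrow> ('s \<Rightarrow> 's pmf) \<Rightarrow> real \<Rightarrow> nat" where
  "mixing_time \<Omega> K \<epsilon> = (LEAST t. mixing_dist \<Omega> K t \<le> \<epsilon>)"

definition edge_flow :: "'s set \<Rightarrow> ('s \<Rightarrow> 's pmf) \<Rightarrow> 's set \<Rightarrow> 's set \<Rightarrow> real" where
  "edge_flow \<Omega> K A B = (\<Sum>x\<in>A. \<Sum>y\<in>B. pmf (stationary_pmf \<Omega> K) x * pmf (K x) y)"

definition bottleneck_ratio :: "'s set \<Rightarrow> ('s \<Rightarrow> 's pmf) \<Rightarrow> 's set \<Rightarrow> real" where
  "bottleneck_ratio \<Omega> K S =
     edge_flow \<Omega> K S (\<Omega> - S) / measure_pmf.prob (stationary_pmf \<Omega> K) S"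

definition cheeger_constant :: "'s set \<Rightarrow> ('s \<Rightarrow> 's pmf) \<Rightarrow> real" where
  "cheeger_constant \<Omega> K =
     (MIN S\<in>{S. S \<subseteq> \<Omega> \<and> S \<noteq> {} \<and> measure_pmf.prob (stationary_pmf \<Omega> K) S \<le> 1/2}.
        bottleneck_ratio \<Omega> K S)"

section \<open>Attracting random walks\<close>

text \<open>Configurations are extended by \<open>0\<close> outside the vertex set, so that \<open>\<Omega>\<close> is finite.\<close>

definition arw_states :: "('a, 'b) pre_digraph \<Rightarrow> nat \<Rightarrow> ('a \<Rightarrow> nat) set" where
  "arw_states G n = {x. (\<forall>i. i \<notin> verts G \<longrightarrow> x i = 0) \<and> (\<Sum>i\<in>verts G. x i) = n}"

text \<open>
  The location of a uniformly chosen particle: the particles of \<open>x\<close> are enumerated as the pairs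
  \<open>(i, m)\<close> with \<open>m < x i\<close>.
\<close>

definition arw_pick :: "('a, 'b) pre_digraph \<Rightarrow> ('a \<Rightarrow> nat) \<Rightarrow> 'a pmf" where
  "arw_pick G x = map_pmf fst (pmf_of_set (SIGMA i:verts G. {..<x i}))"

definition neighbors :: "('a, 'b) pre_digraph \<Rightarrow> 'a \<Rightarrow> 'a set" where
  "neighbors G i = {j. i \<rightarrow>\<^bsub>G\<^esub> j}"

definition arw_weight :: "nat \<Rightarrow> real \<Rightarrow> ('a \<Rightarrow> nat) \<Rightarrow> 'a \<Rightarrow> 'a \<Rightarrow> real" where
  "arw_weight n \<beta> x i j =
     (if j = i then exp (\<beta> / real n * (real (x i) - 1)) else exp (\<beta> / real n * real (x j)))"

definition arw_Z :: "('a, 'b) pre_digraph \<Rightarrow> nat \<Rightarrow> real \<Rightarrow> ('a \<Rightarrow> nat) \<Rightarrow> 'a \<Rightarrow> real" where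
  "arw_Z G n \<beta> x i =
     (\<Sum>l\<in>neighbors G i. arw_weight n \<beta> x i l) + arw_weight n \<beta> x i i"

text \<open>The new location of a particle chosen at \<open>i\<close>; see \<open>pmf_arw_jump\<close> below.\<close>

definition arw_jump ::
    "('a, 'b) pre_digraph \<Rightarrow> nat \<Rightarrow> real \<Rightarrow> ('a \<Rightarrow> nat) \<Rightarrow> 'a \<Rightarrow> 'a pmf" where
  "arw_jump G n \<beta> x i =
     embed_pmf (\<lambda>j. if j \<in> insert i (neighbors G i)
                    then arw_weight n \<beta> x i j / arw_Z G n \<beta> x i else 0)"

definition move_particle :: "('a \<Rightarrow> nat) \<Rightarrow> 'a \<Rightarrow> 'a \<Rightarrow> 'a \<Rightarrow> nat" where
  "move_particle x i j = (let x' = x(i := x i - 1) in x'(j := x' j + 1))"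

definition arw_kernel ::
    "('a, 'b) pre_digraph \<Rightarrow> nat \<Rightarrow> real \<Rightarrow> ('a \<Rightarrow> nat) \<Rightarrow> ('a \<Rightarrow> nat) pmf" where
  "arw_kernel G n \<beta> x =
     do {
       i \<leftarrow> arw_pick G x;
       j \<leftarrow> arw_jump G n \<beta> x i;
       return_pmf (move_particle x i j)
     }"

definition arw_mixing_time :: "('a, 'b) pre_digraph \<Rightarrow> nat \<Rightarrow> real \<Rightarrow> nat" where
  "arw_mixing_time G n \<beta> = mixing_time (arw_states G n) (arw_kernel G n \<beta>) (1/4)"

definition arw_cheeger :: "('a, 'b) pre_digraph \<Rightarrow> nat \<Rightarrow> real \<Rightarrow> real" where
  "arw_cheeger G n \<beta> = cheeger_constant (arw_states G n) (arw_kernel G n \<beta>)"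

section \<open>The definitions are well-formed\<close>

lemma finite_arw_states:
  assumes "finite (verts G)"
  shows "finite (arw_states G n)"
proof -
  have "arw_states G n \<subseteq> {x. \<forall>i. (i \<in> verts G \<longrightarrow> x i \<in> {..n}) \<and> (i \<notin> verts G \<longrightarrow> x i = 0)}"
    using assms by (auto simp: arw_states_def intro!: member_le_sum)
  moreover have "finite {x. \<forall>i. (i \<in> verts G \<longrightarrow> x i \<in> {..n}) \<and> (i \<notin> verts G \<longrightarrow> x i = (0::nat))}"
    using assms by (intro finite_set_of_finite_funs) auto
  ultimately show ?thesis by (rule finite_subset)
qed

lemma pmf_arw_pick:
  assumes "finite (verts G)" "x \<in> arw_states G n" "n \<ge> 1"
  shows "pmf (arw_pick G x) i = real (x i) / real n"
proof -
  let ?A = "SIGMA i:verts G. {..<x i}"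
  have card: "card ?A = n" using assms by (simp add: arw_states_def)
  have fin: "finite ?A" using assms by simp
  have ne: "?A \<noteq> {}" using card \<open>n \<ge> 1\<close> by (metis card.empty not_one_le_zero)
  have eq: "?A \<inter> fst -` {i} = (\<lambda>m. (i, m)) ` {..<x i}"
    using assms(2) by (auto simp: arw_states_def)
  have "card (?A \<inter> fst -` {i}) = x i"
    unfolding eq by (subst card_image) (auto intro: inj_onI)
  then show ?thesis
    by (simp add: arw_pick_def pmf_map measure_pmf_of_set[OF ne fin] card)
qed

context
  fixes G :: "('a, 'b) pre_digraph"
  assumes G: "graph G"
begin

interpretation graph G by (rule G)

lemma finite_neighbors: "finite (neighbors G i)"
  by (rule finite_subset[OF _ finite_verts]) (auto simp: neighbors_def adj_in_verts)

lemma not_self_neighbor: "i \<notin> neighbors G i"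
  using adj_not_same by (auto simp: neighbors_def)

lemma arw_Z_pos: "arw_Z G n \<beta> x i > 0"
  unfolding arw_Z_def
  by (intro add_nonneg_pos sum_nonneg) (auto simp: arw_weight_def)

lemma pmf_arw_jump:
  "pmf (arw_jump G n \<beta> x i) j =
     (if j \<in> insert i (neighbors G i) then arw_weight n \<beta> x i j / arw_Z G n \<beta> x i else 0)"
  unfolding arw_jump_def
proof (rule pmf_embed_pmf)
  let ?N = "insert i (neighbors G i)"
  let ?f = "\<lambda>j. if j \<in> ?N then arw_weight n \<beta> x i j / arw_Z G n \<beta> x i else 0"
  show nonneg: "0 \<le> ?f j" for j
    using arw_Z_pos[of n \<beta> x i] by (simp add: arw_weight_def)
  have "(\<integral>\<^sup>+ j. ennreal (?f j) \<partial>count_space UNIV) = (\<Sum>j\<in>?N. ennreal (?f j))"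
    using finite_neighbors by (intro nn_integral_count_space') auto
  also have "\<dots> = ennreal (\<Sum>j\<in>?N. ?f j)"
    by (rule sum_ennreal) (rule nonneg)
  also have "(\<Sum>j\<in>?N. ?f j) = (\<Sum>j\<in>?N. arw_weight n \<beta> x i j) / arw_Z G n \<beta> x i"
    unfolding sum_divide_distrib by (intro sum.cong) auto
  also have "(\<Sum>j\<in>?N. arw_weight n \<beta> x i j) = arw_Z G n \<beta> x i"
    using finite_neighbors not_self_neighbor by (simp add: arw_Z_def)
  finally show "(\<integral>\<^sup>+ j. ennreal (?f j) \<partial>count_space UNIV) = 1"
    using arw_Z_pos[of n \<beta> x i] by simp
qed

lemma move_particle_in_states:
  assumes x: "x \<in> arw_states G n" and i: "i \<in> verts G" "x i \<ge> 1" and j: "j \<in> verts G"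
  shows "move_particle x i j \<in> arw_states G n"
proof -
  have "(\<Sum>l\<in>verts G. move_particle x i j l) + 1 = (\<Sum>l\<in>verts G. x l) + 1"
  proof -
    have "(\<Sum>l\<in>verts G. move_particle x i j l) + (\<Sum>l\<in>verts G. if l = i then 1 else 0)
        = (\<Sum>l\<in>verts G. x l) + (\<Sum>l\<in>verts G. if l = j then 1 else 0)"
      unfolding sum.distrib[symmetric]
      using i by (intro sum.cong) (auto simp: move_particle_def)
    then show ?thesis using i j by simp
  qed
  then show ?thesis
    using x i j by (auto simp: arw_states_def move_particle_def Let_def)
qed

lemma set_arw_kernel:
  assumes "x \<in> arw_states G n" "n \<ge> 1"
  shows "set_pmf (arw_kernel G n \<beta> x) \<subseteq> arw_states G n"
proof
  fix y assume "y \<in> set_pmf (arw_kernel G n \<beta> x)"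
  then obtain i j where i: "i \<in> set_pmf (arw_pick G x)"
    and j: "j \<in> set_pmf (arw_jump G n \<beta> x i)" and y: "y = move_particle x i j"
    by (auto simp: arw_kernel_def)
  have xi: "x i \<ge> 1"
    using i assms pmf_arw_pick[OF finite_verts assms, of i] by (auto simp: set_pmf_iff)
  have iv: "i \<in> verts G" using xi assms by (auto simp: arw_states_def)
  have "j \<in> insert i (neighbors G i)"
    using j by (auto simp: set_pmf_iff pmf_arw_jump split: if_splits)
  then have "j \<in> verts G" using iv by (auto simp: neighbors_def adj_in_verts)
  then show "y \<in> arw_states G n"
    using y move_particle_in_states assms(1) iv xi by blast
qed

end

end

theory Submission
  imports Defs "HOL-Real_Asymp.Real_Asymp"
begin

text \<open>
  Both regimes rest on the inequality \<open>1 / 4 \<le> t_mix * \<Phi>(S)\<close> for \<open>\<pi>(S) \<le> 1 / 2\<close>: an upper bound on the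
  mixing time bounds the Cheeger constant from below, and a small bottleneck bounds the mixing time
  from below.

  For small \<open>\<beta>\<close>, a function \<open>g\<close> on the vertices is measured by the sum over times \<open>s < T\<close> of the
  oscillation of \<open>q\<^sup>s g\<close>, where \<open>q\<close> is the walk of a single free particle. If \<open>q\<^sup>T\<close> halves
  oscillations, one application of \<open>q\<close> contracts this sum by the factor \<open>1 - 1 / (2 T)\<close>. Applied to
  the position of one particle, with the others fixed, it gives a Lipschitz seminorm of functions on
  configurations. One step of the chain moves the distinguished particle with probability \<open>1 / n\<close>,
  and the interaction perturbs the seminorm by a relative \<open>O(\<beta> / n)\<close>, so the seminorm contracts by
  \<open>1 - c / n\<close>, while it controls the oscillation up to a factor \<open>n\<close>.

  For large \<open>\<beta>\<close>, the configurations with almost all particles at a vertex \<open>v\<close> form a trap: a weighted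
  sum of the distances of the particles to \<open>v\<close> has negative drift in a band around it. The stationary
  distribution is not explicit, so its mass on the edge of the trap is bounded through the stationarity
  of a truncated exponential of this sum. The traps of two vertices are disjoint, so one of them has
  stationary mass at most \<open>1 / 2\<close>.
\<close>

section \<open>Finite chains\<close>

text \<open>The set of pairs is symmetric and contains the diagonal, so plain differences have the
  same maximum as their absolute values.\<close>

definition osc :: "'s set \<Rightarrow> ('s \<Rightarrow> real) \<Rightarrow> real" where
  "osc A f = Max ((\<lambda>(x, y). f x - f y) ` (A \<times> A))"

lemma osc_ge:
  assumes "finite A" "x \<in> A" "y \<in> A"
  shows "f x - f y \<le> osc A f"
  unfolding osc_def using assms by (intro Max_ge) force+

lemma osc_le:
  assumes "finite A" "A \<noteq> {}" "\<And>x y. x \<in> A \<Longrightarrow> y \<in> A \<Longrightarrow> f x - f y \<le> c"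
  shows "osc A f \<le> c"
  unfolding osc_def using assms by (subst Max_le_iff) auto

lemma osc_abs_ge:
  assumes "finite A" "x \<in> A" "y \<in> A"
  shows "\<bar>f x - f y\<bar> \<le> osc A f"
  using osc_ge[of A x y f] osc_ge[of A y x f] assms by linarith

lemma osc_nonneg:
  assumes "finite A" "A \<noteq> {}"
  shows "0 \<le> osc A f"
  using assms osc_ge[of A _ _ f] by (metis diff_self ex_in_conv)

lemma osc_le_bound:
  assumes "finite A" "A \<noteq> {}" "\<And>x. x \<in> A \<Longrightarrow> \<bar>f x\<bar> \<le> c"
  shows "osc A f \<le> 2 * c"
proof (intro osc_le assms(1,2))
  fix x y assume "x \<in> A" "y \<in> A"
  then show "f x - f y \<le> 2 * c" using assms(3)[of x] assms(3)[of y] by linarith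
qed

lemma osc_add_le:
  assumes "finite A" "A \<noteq> {}"
  shows "osc A (\<lambda>x. f x + g x) \<le> osc A f + osc A g"
proof (intro osc_le assms)
  fix x y assume "x \<in> A" "y \<in> A"
  then show "f x + g x - (f y + g y) \<le> osc A f + osc A g"
    using osc_ge[of A x y f] osc_ge[of A x y g] assms by linarith
qed

lemma osc_cmult_le:
  assumes "finite A" "A \<noteq> {}" "0 \<le> c"
  shows "osc A (\<lambda>x. c * f x) \<le> c * osc A f"
proof (intro osc_le assms)
  fix x y assume "x \<in> A" "y \<in> A"
  then show "c * f x - c * f y \<le> c * osc A f"
    using osc_ge[of A x y f] assms by (simp flip: right_diff_distrib add: mult_left_mono)
qed

lemma finite_attains_max:
  fixes f :: "'s \<Rightarrow> real"
  assumes "finite A" "A \<noteq> {}"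
  obtains a where "a \<in> A" "\<And>z. z \<in> A \<Longrightarrow> f z \<le> f a"
proof -
  have "Max (f ` A) \<in> f ` A" using assms by (intro Max_in) auto
  then obtain a where "a \<in> A" "f a = Max (f ` A)" by auto
  with that show ?thesis using assms by simp
qed

lemma finite_attains_min:
  fixes f :: "'s \<Rightarrow> real"
  assumes "finite A" "A \<noteq> {}"
  obtains b where "b \<in> A" "\<And>z. z \<in> A \<Longrightarrow> f b \<le> f z"
  using finite_attains_max[OF assms, of "\<lambda>z. - f z"] by auto

text \<open>For u = -v < 0 the bound follows from exp v \<ge> 1 + v + v^2/2 and (1 - v + v^2)(1 + v
  + v^2/2) \<ge> 1. It controls the second-order term of the exponential supermartingale in the low
  temperature regime.\<close>

lemma exp_le_quadratic:
  fixes u :: real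
  assumes u: "\<bar>u\<bar> \<le> 1"
  shows "exp u \<le> 1 + u + u\<^sup>2"
proof (cases "0 \<le> u")
    case True
    then show ?thesis using exp_bound[of u] u by linarith
  next
    case False
    let ?v = "- u"
    have v: "0 \<le> ?v" "?v \<le> 1" using False u by linarith+
    have "1 + ?v + ?v\<^sup>2 / 2 \<le> exp ?v" using exp_lower_Taylor_quadratic v(1) by blast
    moreover have "1 \<le> (1 - ?v + ?v\<^sup>2) * (1 + ?v + ?v\<^sup>2 / 2)"
    proof -
      have "(1 - ?v + ?v\<^sup>2) * (1 + ?v + ?v\<^sup>2 / 2) = 1 + ?v\<^sup>2 / 2 * (1 + ?v + ?v\<^sup>2)"
        by (simp add: field_simps power2_eq_square)
      moreover have "0 \<le> ?v\<^sup>2 / 2 * (1 + ?v + ?v\<^sup>2)" using v by (intro mult_nonneg_nonneg) auto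
      ultimately show ?thesis by linarith
    qed
    moreover have "0 \<le> 1 - ?v + ?v\<^sup>2" using v by (simp add: power2_eq_square)
    ultimately have "1 \<le> (1 - ?v + ?v\<^sup>2) * exp ?v"
      using mult_left_mono[of "1 + ?v + ?v\<^sup>2 / 2" "exp ?v" "1 - ?v + ?v\<^sup>2"] by linarith
    then have "exp (- ?v) \<le> 1 - ?v + ?v\<^sup>2" by (simp add: exp_minus field_simps)
    then show ?thesis by simp
  qed

section \<open>The transition operator of a finite chain\<close>

locale finite_chain =
  fixes \<Omega> :: "'s set" and K :: "'s \<Rightarrow> 's pmf"
  assumes finite_states: "finite \<Omega>"
    and states_nonempty: "\<Omega> \<noteq> {}"
    and closed: "\<And>x. x \<in> \<Omega> \<Longrightarrow> set_pmf (K x) \<subseteq> \<Omega>"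
begin

text \<open>The transition matrix acts on functions rather than on laws:
  \<open>(step ^^ t) f x\<close> is the expectation of \<open>f\<close> after \<open>t\<close> steps
  from \<open>x\<close> (\<open>expectation_chain_dist\<close>), so convergence becomes decay of
  oscillations.\<close>

definition step :: "('s \<Rightarrow> real) \<Rightarrow> 's \<Rightarrow> real" where
  "step f x = (\<Sum>y\<in>\<Omega>. pmf (K x) y * f y)"

lemma step_eq_expectation:
  "x \<in> \<Omega> \<Longrightarrow> step f x = measure_pmf.expectation (K x) f"
  unfolding step_def using closed[of x] finite_states
  by (subst integral_measure_pmf_real[of \<Omega>]) (auto simp: mult.commute)

lemma sum_pmf_states: "x \<in> \<Omega> \<Longrightarrow> (\<Sum>y\<in>\<Omega>. pmf (K x) y) = 1"
  using closed[of x] finite_states by (intro sum_pmf_eq_1)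

lemma step_const [simp]: "x \<in> \<Omega> \<Longrightarrow> step (\<lambda>_. c) x = c"
  using sum_pmf_states[of x] by (simp add: step_def flip: sum_distrib_right)

lemma step_add: "step (\<lambda>x. f x + g x) = (\<lambda>x. step f x + step g x)"
  by (simp add: step_def fun_eq_iff algebra_simps sum.distrib)

lemma step_cmult: "step (\<lambda>x. c * f x) = (\<lambda>x. c * step f x)"
  by (simp add: step_def fun_eq_iff sum_distrib_left algebra_simps)

lemma step_mono: "(\<And>y. y \<in> \<Omega> \<Longrightarrow> f y \<le> g y) \<Longrightarrow> step f x \<le> step g x"
  by (auto simp: step_def intro!: sum_mono mult_left_mono)

lemma step_cong: "(\<And>y. y \<in> \<Omega> \<Longrightarrow> f y = g y) \<Longrightarrow> step f x = step g x"
  by (auto simp: step_def)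

lemma steps_const [simp]: "x \<in> \<Omega> \<Longrightarrow> (step ^^ t) (\<lambda>_. c) x = c"
proof (induction t arbitrary: x)
  case (Suc t)
  have "(step ^^ Suc t) (\<lambda>_. c) x = step (\<lambda>_. c) x"
    using Suc.IH by (auto intro!: step_cong)
  then show ?case using Suc.prems by simp
qed simp

lemma steps_add: "(step ^^ t) (\<lambda>x. f x + g x) = (\<lambda>x. (step ^^ t) f x + (step ^^ t) g x)"
  by (induction t) (simp_all add: step_add)

lemma steps_cmult: "(step ^^ t) (\<lambda>x. c * f x) = (\<lambda>x. c * (step ^^ t) f x)"
  by (induction t) (simp_all add: step_cmult)

lemma steps_mono:
  "(\<And>y. y \<in> \<Omega> \<Longrightarrow> f y \<le> g y) \<Longrightarrow> x \<in> \<Omega> \<Longrightarrow> (step ^^ t) f x \<le> (step ^^ t) g x"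
  by (induction t arbitrary: x) (auto intro: step_mono)

lemma steps_cong:
  "(\<And>y. y \<in> \<Omega> \<Longrightarrow> f y = g y) \<Longrightarrow> x \<in> \<Omega> \<Longrightarrow> (step ^^ t) f x = (step ^^ t) g x"
  by (intro antisym steps_mono) auto

text \<open>Averages of \<open>f\<close> stay between its minimum and its maximum.\<close>

lemma osc_steps_le: "osc \<Omega> ((step ^^ t) f) \<le> osc \<Omega> f"
proof (intro osc_le finite_states states_nonempty)
  fix x y assume xy: "x \<in> \<Omega>" "y \<in> \<Omega>"
  obtain a where a: "a \<in> \<Omega>" "\<And>z. z \<in> \<Omega> \<Longrightarrow> f z \<le> f a"
    by (rule finite_attains_max[OF finite_states states_nonempty, of f]) blast
  obtain b where b: "b \<in> \<Omega>" "\<And>z. z \<in> \<Omega> \<Longrightarrow> f b \<le> f z"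
    by (rule finite_attains_min[OF finite_states states_nonempty, of f]) blast
  have "(step ^^ t) f x \<le> (step ^^ t) (\<lambda>_. f a) x" using xy a by (intro steps_mono)
  moreover have "(step ^^ t) (\<lambda>_. f b) y \<le> (step ^^ t) f y" using xy b by (intro steps_mono)
  ultimately show "(step ^^ t) f x - (step ^^ t) f y \<le> osc \<Omega> f"
    using xy osc_ge[OF finite_states a(1) b(1), of f] by simp
qed

lemma set_chain_dist: "x \<in> \<Omega> \<Longrightarrow> set_pmf (chain_dist K t x) \<subseteq> \<Omega>"
proof (induction t)
  case (Suc t)
  then show ?case using closed by (auto simp: chain_dist_def)
qed (simp add: chain_dist_def)

lemma expectation_bind_step:
  assumes "set_pmf \<mu> \<subseteq> \<Omega>"
  shows "measure_pmf.expectation (bind_pmf \<mu> K) f = measure_pmf.expectation \<mu> (step f)"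
proof -
  have "measure_pmf.expectation (bind_pmf \<mu> K) f
      = (\<Sum>a\<in>\<Omega>. pmf \<mu> a *\<^sub>R measure_pmf.expectation (K a) f)"
    using assms finite_states closed by (intro pmf_expectation_bind) (auto intro: finite_subset)
  also have "\<dots> = (\<Sum>a\<in>\<Omega>. step f a * pmf \<mu> a)"
    by (intro sum.cong) (auto simp: step_eq_expectation)
  also have "\<dots> = measure_pmf.expectation \<mu> (step f)"
    using assms finite_states by (subst integral_measure_pmf_real[of \<Omega>]) auto
  finally show ?thesis .
qed

lemma expectation_chain_dist:
  "x \<in> \<Omega> \<Longrightarrow> measure_pmf.expectation (chain_dist K t x) f = (step ^^ t) f x"
proof (induction t arbitrary: f)
  case (Suc t)
  have "chain_dist K (Suc t) x = bind_pmf (chain_dist K t x) K"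
    by (simp add: chain_dist_def)
  then show ?case
    using Suc expectation_bind_step[OF set_chain_dist[OF Suc.prems]] by (simp add: funpow_swap1)
qed (simp add: chain_dist_def)

lemma prob_chain_dist:
  "x \<in> \<Omega> \<Longrightarrow> measure_pmf.prob (chain_dist K t x) A = (step ^^ t) (indicator A) x"
  using expectation_chain_dist[of x t "indicator A"] by simp

end

section \<open>Convergence to a unique stationary distribution\<close>

locale ergodic_chain = finite_chain +
  assumes lazy: "\<And>x. x \<in> \<Omega> \<Longrightarrow> 0 < pmf (K x) x"
    and irreducible: "\<And>x y. x \<in> \<Omega> \<Longrightarrow> y \<in> \<Omega> \<Longrightarrow> (\<lambda>x y. 0 < pmf (K x) y)\<^sup>*\<^sup>* x y"
begin

lemma steps_indicator_nonneg: "x \<in> \<Omega> \<Longrightarrow> 0 \<le> (step ^^ t) (indicator A) x"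
  using steps_mono[of "\<lambda>_. 0" "indicator A" x t] by simp

lemma step_pos:
  assumes "x \<in> \<Omega>" "y \<in> \<Omega>" "0 < pmf (K x) y" "0 < f y" "\<And>z. z \<in> \<Omega> \<Longrightarrow> 0 \<le> f z"
  shows "0 < step f x"
  unfolding step_def using assms finite_states
  by (intro sum_pos2[where i = y]) auto

text \<open>Induction backwards along a path from \<open>x\<close> to \<open>y\<close>. Positivity
  for all later times, which comes from laziness at \<open>y\<close>, allows one common time to be
  chosen for all pairs of states.\<close>

lemma steps_indicator_eventually_pos:
  assumes "x \<in> \<Omega>" "y \<in> \<Omega>"
  shows "\<exists>t. \<forall>t'\<ge>t. 0 < (step ^^ t') (indicator {y}) x"
  using irreducible[OF assms] assms
proof (induction rule: converse_rtranclp_induct)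
  case base
  have "0 < (step ^^ t') (indicator {y}) y" for t'
  proof (induction t')
    case (Suc t')
    then show ?case
      using base lazy steps_indicator_nonneg by (auto intro!: step_pos[of y y])
  qed simp
  then show ?case by blast
next
  case (step x z)
  have z: "z \<in> \<Omega>" using step closed[of x] by (auto simp: set_pmf_iff)
  then obtain t where t: "\<forall>t'\<ge>t. 0 < (finite_chain.step \<Omega> K ^^ t') (indicator {y}) z"
    using step by blast
  have "0 < (finite_chain.step \<Omega> K ^^ t') (indicator {y}) x" if "t' \<ge> Suc t" for t'
    using that step z t steps_indicator_nonneg
    by (cases t') (auto intro!: step_pos[of x z])
  then show ?case by blast
qed

lemma doeblin: "\<exists>\<epsilon>>0. \<exists>T. \<forall>x\<in>\<Omega>. \<forall>y\<in>\<Omega>. \<epsilon> \<le> (step ^^ T) (indicator {y}) x"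
proof -
  obtain t where t: "\<And>x y t'. x \<in> \<Omega> \<Longrightarrow> y \<in> \<Omega> \<Longrightarrow> t' \<ge> t x y \<Longrightarrow>
      0 < (step ^^ t') (indicator {y}) x"
    using steps_indicator_eventually_pos by metis
  define T where "T = Max ((\<lambda>(x, y). t x y) ` (\<Omega> \<times> \<Omega>))"
  have T: "t x y \<le> T" if "x \<in> \<Omega>" "y \<in> \<Omega>" for x y
    unfolding T_def using that finite_states by (intro Max_ge) force+
  define E where "E = (\<lambda>(x, y). (step ^^ T) (indicator {y}) x) ` (\<Omega> \<times> \<Omega>)"
  have E: "finite E" "E \<noteq> {}" using finite_states states_nonempty by (auto simp: E_def)
  have "0 < Min E" using E t T by (subst Min_gr_iff) (auto simp: E_def)
  moreover have "Min E \<le> (step ^^ T) (indicator {y}) x" if "x \<in> \<Omega>" "y \<in> \<Omega>" for x y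
    using E that by (intro Min_le) (force simp: E_def)+
  ultimately show ?thesis by blast
qed

text \<open>From every state the minimiser \<open>b\<close> of \<open>g\<close> is hit at time
  \<open>T\<close> with probability at least \<epsilon>. This lowers the upper bound
  \<open>g a\<close> by \<epsilon> times the oscillation, while the lower bound \<open>g b\<close>
  persists.\<close>

lemma osc_steps_contract:
  assumes "0 < \<epsilon>" "\<And>x y. x \<in> \<Omega> \<Longrightarrow> y \<in> \<Omega> \<Longrightarrow> \<epsilon> \<le> (step ^^ T) (indicator {y}) x"
  shows "osc \<Omega> ((step ^^ T) g) \<le> (1 - \<epsilon>) * osc \<Omega> g"
proof (intro osc_le finite_states states_nonempty)
  fix x y assume xy: "x \<in> \<Omega>" "y \<in> \<Omega>"
  obtain a where a: "a \<in> \<Omega>" "\<And>z. z \<in> \<Omega> \<Longrightarrow> g z \<le> g a"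
    by (rule finite_attains_max[OF finite_states states_nonempty, of g]) blast
  obtain b where b: "b \<in> \<Omega>" "\<And>z. z \<in> \<Omega> \<Longrightarrow> g b \<le> g z"
    by (rule finite_attains_min[OF finite_states states_nonempty, of g]) blast
  have osc: "osc \<Omega> g = g a - g b"
  proof (rule antisym)
    show "osc \<Omega> g \<le> g a - g b"
    proof (intro osc_le finite_states states_nonempty)
      fix u v assume "u \<in> \<Omega>" "v \<in> \<Omega>"
      then show "g u - g v \<le> g a - g b" using a(2)[of u] b(2)[of v] by linarith
    qed
  qed (rule osc_ge[OF finite_states a(1) b(1)])
  have "(step ^^ T) g x \<le> (step ^^ T) (\<lambda>z. g a + - (g a - g b) * indicator {b} z) x"
    using a(2) xy by (intro steps_mono) (simp_all add: indicator_def)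
  also have "\<dots> = g a + - (g a - g b) * (step ^^ T) (indicator {b}) x"
    using xy by (simp only: steps_add steps_cmult steps_const)
  also have "\<dots> \<le> g a - (g a - g b) * \<epsilon>"
    using mult_left_mono[OF assms(2)[OF xy(1) b(1)], of "g a - g b"] a(2)[OF b(1)]
    by (simp add: algebra_simps)
  finally have "(step ^^ T) g x \<le> g a - (g a - g b) * \<epsilon>" .
  moreover have "g b \<le> (step ^^ T) g y"
    using steps_mono[of "\<lambda>_. g b" g y T, OF b(2) xy(2)] xy(2) by simp
  ultimately show "(step ^^ T) g x - (step ^^ T) g y \<le> (1 - \<epsilon>) * osc \<Omega> g"
    by (simp add: osc algebra_simps)
qed

text \<open>Iterates the contraction over \<open>m\<close> blocks of length \<open>T\<close>. The
  resulting time is uniform in the function, which both the mixing time and the choice of the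
  contraction time of the free walk require.\<close>

lemma osc_steps_small:
  assumes "0 < (\<delta>::real)"
  obtains T where "\<And>g. osc \<Omega> ((step ^^ T) g) \<le> \<delta> * osc \<Omega> g"
proof -
  obtain \<epsilon> T where \<epsilon>: "0 < \<epsilon>"
    "\<And>x y. x \<in> \<Omega> \<Longrightarrow> y \<in> \<Omega> \<Longrightarrow> \<epsilon> \<le> (step ^^ T) (indicator {y}) x"
    using doeblin by blast
  obtain x where x: "x \<in> \<Omega>" using states_nonempty by blast
  \<comment> \<open>A probability is at most 1, so \<epsilon> \<le> 1 and the factor 1 - \<epsilon>
    is nonnegative, as the induction requires.\<close>
  have "(step ^^ T) (indicator {x}) x \<le> (step ^^ T) (\<lambda>_. 1) x"
    by (intro steps_mono x) (simp add: indicator_def)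
  then have "\<epsilon> \<le> 1" using \<epsilon>(2)[OF x x] x by simp
  have pow: "osc \<Omega> ((step ^^ (m * T)) g) \<le> (1 - \<epsilon>) ^ m * osc \<Omega> g" for m g
  proof (induction m)
    case (Suc m)
    have "osc \<Omega> ((step ^^ (Suc m * T)) g) \<le> (1 - \<epsilon>) * osc \<Omega> ((step ^^ (m * T)) g)"
      using osc_steps_contract[OF \<epsilon>, of "(step ^^ (m * T)) g"] by (simp only: mult_Suc funpow_add o_apply)
    also have "\<dots> \<le> (1 - \<epsilon>) * ((1 - \<epsilon>) ^ m * osc \<Omega> g)"
      using Suc \<open>\<epsilon> \<le> 1\<close> by (intro mult_left_mono) auto
    finally show ?case by (simp add: mult.assoc)
  qed simp
  obtain m where m: "(1 - \<epsilon>) ^ m < \<delta>"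
    using real_arch_pow_inv[OF assms, of "1 - \<epsilon>"] \<epsilon>(1) by (metis diff_less_eq less_add_same_cancel1)
  show ?thesis
  proof (rule that[of "m * T"])
    show "osc \<Omega> ((step ^^ (m * T)) g) \<le> \<delta> * osc \<Omega> g" for g
      using pow[of m g] mult_right_mono[OF less_imp_le[OF m] osc_nonneg[OF finite_states states_nonempty, of g]]
      by linarith
  qed
qed

lemma stationary_expectation_steps:
  assumes "stationary_on \<Omega> K \<pi>"
  shows "measure_pmf.expectation \<pi> ((step ^^ t) f) = measure_pmf.expectation \<pi> f"
proof (induction t)
  case (Suc t)
  then show ?case
    using assms expectation_bind_step[of \<pi> "(step ^^ t) f"] by (simp add: stationary_on_def)
qed simp

text \<open>By stationarity the mean of \<open>f\<close> equals the \<pi>-average of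
  \<open>(step ^^ t) f\<close>, and an average differs from any single value by at most the
  oscillation.\<close>

lemma stationary_deviation:
  assumes "stationary_on \<Omega> K \<pi>" "x \<in> \<Omega>"
  shows "\<bar>(step ^^ t) f x - measure_pmf.expectation \<pi> f\<bar> \<le> osc \<Omega> ((step ^^ t) f)"
proof -
  let ?h = "(step ^^ t) f" and ?D = "osc \<Omega> ((step ^^ t) f)"
  have sub: "set_pmf \<pi> \<subseteq> \<Omega>" using assms by (simp add: stationary_on_def)
  have one: "(\<Sum>y\<in>\<Omega>. pmf \<pi> y) = 1" using sub finite_states by (intro sum_pmf_eq_1)
  have "measure_pmf.expectation \<pi> f = measure_pmf.expectation \<pi> ?h"
    using stationary_expectation_steps[OF assms(1)] by simp
  also have "\<dots> = (\<Sum>y\<in>\<Omega>. ?h y * pmf \<pi> y)"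
    using sub finite_states by (intro integral_measure_pmf_real) auto
  finally have "?h x - measure_pmf.expectation \<pi> f = (\<Sum>y\<in>\<Omega>. (?h x - ?h y) * pmf \<pi> y)"
    using one by (simp add: left_diff_distrib sum_subtractf flip: sum_distrib_left)
  also have "\<bar>\<dots>\<bar> \<le> (\<Sum>y\<in>\<Omega>. ?D * pmf \<pi> y)"
    using osc_abs_ge[OF finite_states assms(2)]
    by (intro order_trans[OF sum_abs] sum_mono) (auto simp: abs_mult intro!: mult_right_mono)
  finally show ?thesis using one by (simp flip: sum_distrib_left)
qed

lemma osc_steps_vanish: "0 < (\<delta>::real) \<Longrightarrow> \<exists>T. \<forall>t\<ge>T. osc \<Omega> ((step ^^ t) g) \<le> \<delta>"
proof -
  assume \<delta>: "0 < \<delta>"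
  let ?o = "osc \<Omega> g"
  have o: "0 \<le> ?o" using osc_nonneg finite_states states_nonempty by blast
  \<comment> \<open>Adding 1 to the oscillation avoids division by zero for constant
    \<open>g\<close>.\<close>
  obtain T where T: "\<And>g. osc \<Omega> ((step ^^ T) g) \<le> \<delta> / (?o + 1) * osc \<Omega> g"
    using osc_steps_small[of "\<delta> / (?o + 1)"] \<delta> o by (auto simp: add_nonneg_pos)
  have "\<delta> / (?o + 1) * ?o \<le> \<delta>" using o \<delta> by (simp add: field_simps)
  then have "osc \<Omega> ((step ^^ T) g) \<le> \<delta>" using T[of g] by linarith
  moreover have "osc \<Omega> ((step ^^ t) g) \<le> osc \<Omega> ((step ^^ T) g)" if "t \<ge> T" for t
    using osc_steps_le[of "t - T" "(step ^^ T) g"] that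
    by (metis comp_apply funpow_add le_add_diff_inverse2)
  ultimately have "osc \<Omega> ((step ^^ t) g) \<le> \<delta>" if "t \<ge> T" for t
    using that by (meson order_trans)
  then show ?thesis by (intro exI[of _ T]) blast
qed

text \<open>All values after time \<open>T\<close> are averages of \<open>(step ^^ T) g\<close>, so
  they lie within its oscillation of each other. This gives the Cauchy property and a limit that
  does not depend on the starting state.\<close>

lemma steps_converge: "\<exists>l. \<forall>x\<in>\<Omega>. (\<lambda>t. (step ^^ t) g x) \<longlonglongrightarrow> l"
proof -
  obtain x0 where x0: "x0 \<in> \<Omega>" using states_nonempty by blast
  have diff: "\<bar>(step ^^ m) g x - (step ^^ T) g x0\<bar> \<le> osc \<Omega> ((step ^^ T) g)"
    if "m \<ge> T" "x \<in> \<Omega>" for m T x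
  proof -
    let ?h = "(step ^^ T) g" and ?D = "osc \<Omega> ((step ^^ T) g)"
    have eq: "(step ^^ m) g = (step ^^ (m - T)) ?h"
      using that by (metis comp_apply funpow_add le_add_diff_inverse2)
    have "(step ^^ (m - T)) ?h x \<le> (step ^^ (m - T)) (\<lambda>_. ?h x0 + ?D) x"
      using that osc_ge[OF finite_states _ x0, of _ ?h] by (intro steps_mono) (auto simp: algebra_simps)
    moreover have "(step ^^ (m - T)) (\<lambda>_. ?h x0 - ?D) x \<le> (step ^^ (m - T)) ?h x"
      using that osc_ge[OF finite_states x0, of _ ?h] by (intro steps_mono) (auto simp: algebra_simps)
    ultimately show ?thesis using that by (simp add: eq)
  qed
  have "Cauchy (\<lambda>t. (step ^^ t) g x0)"
  proof (rule metric_CauchyI)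
    fix e :: real assume "e > 0"
    then obtain T where T: "osc \<Omega> ((step ^^ T) g) \<le> e / 3"
      using osc_steps_vanish[of "e / 3" g] by auto
    have "dist ((step ^^ m) g x0) ((step ^^ n) g x0) < e" if "m \<ge> T" "n \<ge> T" for m n
      using diff[OF that(1) x0] diff[OF that(2) x0] T \<open>e > 0\<close> unfolding dist_real_def by linarith
    then show "\<exists>M. \<forall>m\<ge>M. \<forall>n\<ge>M. dist ((step ^^ m) g x0) ((step ^^ n) g x0) < e" by blast
  qed
  then obtain l where l: "(\<lambda>t. (step ^^ t) g x0) \<longlonglongrightarrow> l"
    using Cauchy_convergent_iff convergent_def by blast
  have "(\<lambda>t. (step ^^ t) g x) \<longlonglongrightarrow> l" if "x \<in> \<Omega>" for x
  proof (rule Lim_transform[OF l])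
    show "(\<lambda>t. (step ^^ t) g x - (step ^^ t) g x0) \<longlonglongrightarrow> 0"
    proof (rule LIMSEQ_I)
      fix r :: real assume "r > 0"
      then obtain T where T: "\<forall>t\<ge>T. osc \<Omega> ((step ^^ t) g) \<le> r / 2"
        using osc_steps_vanish[of "r / 2" g] by auto
      have "norm ((step ^^ t) g x - (step ^^ t) g x0 - 0) < r" if "t \<ge> T" for t
      proof -
        have "osc \<Omega> ((step ^^ t) g) \<le> r / 2" using T that by blast
        then show ?thesis
          using osc_abs_ge[OF finite_states \<open>x \<in> \<Omega>\<close> x0, of "(step ^^ t) g"] \<open>r > 0\<close>
          by simp
      qed
      then show "\<exists>no. \<forall>n\<ge>no. norm ((step ^^ n) g x - (step ^^ n) g x0 - 0) < r" by blast
    qed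
  qed
  then show ?thesis by blast
qed

text \<open>The candidate mass at \<open>y\<close> is the limiting probability of being at
  \<open>y\<close> from a fixed start. It is stationary because the sequence shifted by one step has
  the same limit.\<close>

lemma stationary_exists: "\<exists>\<pi>. stationary_on \<Omega> K \<pi>"
proof -
  obtain x0 where x0: "x0 \<in> \<Omega>" using states_nonempty by blast
  define p where "p y = lim (\<lambda>t. (step ^^ t) (indicator {y}) x0)" for y
  have p: "(\<lambda>t. (step ^^ t) (indicator {y}) x) \<longlonglongrightarrow> p y" if "x \<in> \<Omega>" for x y
    unfolding p_def using steps_converge[of "indicator {y}"] that x0 limI by metis
  have repr: "f x = (\<Sum>y\<in>\<Omega>. f y * indicator {y} x)" if "x \<in> \<Omega>" for f :: "'a \<Rightarrow> real" and x
    using that finite_states by (simp add: indicator_def)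
  \<comment> \<open>Expansion in indicators reduces the limit for an arbitrary function to the
    limits that define \<open>p\<close>.\<close>
  have steps_sum: "(step ^^ t) f x = (\<Sum>y\<in>\<Omega>. f y * (step ^^ t) (indicator {y}) x)"
    if "x \<in> \<Omega>" for f x t
    using that
  proof (induction t arbitrary: x)
    case (Suc t)
    have "(step ^^ Suc t) f x = step (\<lambda>z. \<Sum>y\<in>\<Omega>. f y * (step ^^ t) (indicator {y}) z) x"
      using Suc.IH by (auto intro!: step_cong)
    also have "\<dots> = (\<Sum>y\<in>\<Omega>. f y * (step ^^ Suc t) (indicator {y}) x)"
      unfolding funpow.simps o_apply step_def sum_distrib_left
      by (subst sum.swap, intro sum.cong refl) (simp add: mult_ac)
    finally show ?case .
  qed (simp add: repr[symmetric])
  have lim: "(\<lambda>t. (step ^^ t) f x0) \<longlonglongrightarrow> (\<Sum>y\<in>\<Omega>. f y * p y)" for f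
    by (subst steps_sum[OF x0]) (intro tendsto_sum tendsto_mult tendsto_const p x0)
  have p_nonneg: "0 \<le> p y" for y
    using p[OF x0] by (rule LIMSEQ_le_const) (use steps_indicator_nonneg[OF x0] in blast)
  have p_outside: "p y = 0" if "y \<notin> \<Omega>" for y
  proof -
    have "(step ^^ t) (indicator {y}) x0 = (step ^^ t) (\<lambda>_. 0) x0" for t
      using that by (intro steps_cong x0) (auto simp: indicator_def)
    then have "(step ^^ t) (indicator {y}) x0 = 0" for t using x0 by simp
    then show ?thesis using p[OF x0, of y] by (simp add: LIMSEQ_const_iff)
  qed
  have p_sum: "(\<Sum>y\<in>\<Omega>. p y) = 1"
    using lim[of "\<lambda>_. 1"] x0 by (simp add: LIMSEQ_const_iff)
  have pmf_p: "pmf (embed_pmf p) y = p y" for y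
  proof (rule pmf_embed_pmf[OF p_nonneg])
    have "(\<integral>\<^sup>+ y. ennreal (p y) \<partial>count_space UNIV) = (\<Sum>y\<in>\<Omega>. ennreal (p y))"
      using finite_states p_outside by (intro nn_integral_count_space') auto
    also have "\<dots> = 1" using p_nonneg p_sum by (subst sum_ennreal) auto
    finally show "(\<integral>\<^sup>+ y. ennreal (p y) \<partial>count_space UNIV) = 1" .
  qed
  have sub: "set_pmf (embed_pmf p) \<subseteq> \<Omega>"
    using p_outside by (metis pmf_eq_0_set_pmf pmf_p subsetI)
  have "pmf (bind_pmf (embed_pmf p) K) y = pmf (embed_pmf p) y" for y
  proof -
    have "pmf (bind_pmf (embed_pmf p) K) y
        = measure_pmf.expectation (bind_pmf (embed_pmf p) K) (indicator {y})"
      by (simp add: pmf.rep_eq)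
    also have "\<dots> = (\<Sum>x\<in>\<Omega>. step (indicator {y}) x * p x)"
      unfolding expectation_bind_step[OF sub] using sub finite_states
      by (subst integral_measure_pmf_real[of \<Omega>]) (auto simp: pmf_p)
    also have "\<dots> = p y"
    proof (rule LIMSEQ_unique)
      show "(\<lambda>t. (step ^^ Suc t) (indicator {y}) x0) \<longlonglongrightarrow> p y"
        using p[OF x0] LIMSEQ_Suc by blast
      show "(\<lambda>t. (step ^^ Suc t) (indicator {y}) x0) \<longlonglongrightarrow> (\<Sum>x\<in>\<Omega>. step (indicator {y}) x * p x)"
        using lim[of "step (indicator {y})"] by (simp add: funpow_swap1)
    qed
    finally show ?thesis by (simp add: pmf_p)
  qed
  then show ?thesis using sub unfolding stationary_on_def by (metis pmf_eqI)
qed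

text \<open>Iterates of an indicator become almost constant, and both stationary probabilities are
  close to that constant. Two deviations of a third of the gap cannot bridge it.\<close>

lemma stationary_unique:
  assumes "stationary_on \<Omega> K \<pi>" "stationary_on \<Omega> K \<pi>'"
  shows "\<pi> = \<pi>'"
proof (rule pmf_eqI, rule ccontr)
  fix y assume ne: "pmf \<pi> y \<noteq> pmf \<pi>' y"
  obtain x where x: "x \<in> \<Omega>" using states_nonempty by blast
  have "0 < \<bar>pmf \<pi> y - pmf \<pi>' y\<bar> / 3" using ne by simp
  then obtain T where "osc \<Omega> ((step ^^ T) (indicator {y})) \<le> \<bar>pmf \<pi> y - pmf \<pi>' y\<bar> / 3"
    using osc_steps_vanish by blast
  moreover have "measure_pmf.expectation \<mu> (indicator {y}) = pmf \<mu> y" for \<mu>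
    by (simp add: pmf.rep_eq)
  ultimately show False
    using stationary_deviation[OF assms(1) x, of T "indicator {y}"]
      stationary_deviation[OF assms(2) x, of T "indicator {y}"] ne by (auto split: abs_split)
qed

abbreviation "\<pi> \<equiv> stationary_pmf \<Omega> K"

text \<open>Existence and uniqueness make the definite description in \<open>stationary_pmf\<close>
  denote.\<close>

lemma stationary_stationary_pmf: "stationary_on \<Omega> K \<pi>"
  unfolding stationary_pmf_def using stationary_exists stationary_unique by (metis theI)

lemma set_stationary_pmf: "set_pmf \<pi> \<subseteq> \<Omega>"
  using stationary_stationary_pmf by (simp add: stationary_on_def)

lemma expectation_stationary_pmf:
  "measure_pmf.expectation \<pi> f = (\<Sum>x\<in>\<Omega>. pmf \<pi> x * f x)"
  using set_stationary_pmf finite_states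
  by (subst integral_measure_pmf_real[of \<Omega>]) (auto simp: mult.commute)

lemma sum_stationary_steps:
  "(\<Sum>x\<in>\<Omega>. pmf \<pi> x * (step ^^ t) f x) = (\<Sum>x\<in>\<Omega>. pmf \<pi> x * f x)"
  using stationary_expectation_steps[OF stationary_stationary_pmf, of t f]
  by (simp add: expectation_stationary_pmf)

text \<open>The mass at \<open>y\<close> is the \<pi>-average of the probabilities of reaching
  \<open>y\<close> in \<open>T\<close> steps, all of which are at least \<epsilon>.\<close>

lemma stationary_pmf_pos: "y \<in> \<Omega> \<Longrightarrow> 0 < pmf \<pi> y"
proof -
  assume y: "y \<in> \<Omega>"
  obtain \<epsilon> T where \<epsilon>: "0 < \<epsilon>"
    "\<And>x y. x \<in> \<Omega> \<Longrightarrow> y \<in> \<Omega> \<Longrightarrow> \<epsilon> \<le> (step ^^ T) (indicator {y}) x"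
    using doeblin by blast
  have "(\<Sum>x\<in>\<Omega>. pmf \<pi> x * \<epsilon>) \<le> (\<Sum>x\<in>\<Omega>. pmf \<pi> x * (step ^^ T) (indicator {y}) x)"
    using \<epsilon>(2) y by (intro sum_mono mult_left_mono) auto
  also have "\<dots> = pmf \<pi> y"
    using y finite_states by (simp add: sum_stationary_steps indicator_def)
  finally show ?thesis
    using \<epsilon>(1) sum_pmf_eq_1[OF finite_states set_stationary_pmf]
    by (simp flip: sum_distrib_right)
qed

section \<open>Total variation distance and the mixing time\<close>

lemma tv_dist_ge: "\<bar>measure_pmf.prob \<mu> A - measure_pmf.prob \<nu> A\<bar> \<le> tv_dist \<mu> \<nu>"
  unfolding tv_dist_def
proof (rule cSUP_upper)
  show "bdd_above (range (\<lambda>A. \<bar>measure_pmf.prob \<mu> A - measure_pmf.prob \<nu> A\<bar>))"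
    using measure_pmf.prob_le_1[of \<mu>] measure_pmf.prob_le_1[of \<nu>]
    by (intro bdd_aboveI[of _ 1]) (smt (verit) imageE measure_nonneg)
qed simp

lemma mixing_dist_le:
  assumes "\<And>A. osc \<Omega> ((step ^^ t) (indicator A)) \<le> \<epsilon>"
  shows "mixing_dist \<Omega> K t \<le> \<epsilon>"
proof -
  have "tv_dist (chain_dist K t x) \<pi> \<le> \<epsilon>" if x: "x \<in> \<Omega>" for x
    unfolding tv_dist_def
  proof (rule cSUP_least)
    fix A
    have "\<bar>measure_pmf.prob (chain_dist K t x) A - measure_pmf.prob \<pi> A\<bar>
        \<le> osc \<Omega> ((step ^^ t) (indicator A))"
      using stationary_deviation[OF stationary_stationary_pmf x, of t "indicator A"]
      by (simp add: prob_chain_dist[OF x])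
    with assms show "\<bar>measure_pmf.prob (chain_dist K t x) A - measure_pmf.prob \<pi> A\<bar> \<le> \<epsilon>"
      using order_trans by blast
  qed simp
  then show ?thesis
    unfolding mixing_dist_def using finite_states states_nonempty by (subst Max_le_iff) auto
qed

lemma osc_indicator_le: "osc \<Omega> (indicator A) \<le> 1"
  by (intro osc_le finite_states states_nonempty) (auto split: split_indicator)

text \<open>Some time achieves the bound, so the \<open>LEAST\<close> in \<open>mixing_time\<close>
  is attained.\<close>

lemma mixing_dist_mixing_time:
  assumes "0 < \<epsilon>"
  shows "mixing_dist \<Omega> K (mixing_time \<Omega> K \<epsilon>) \<le> \<epsilon>"
proof -
  obtain T where T: "\<And>g. osc \<Omega> ((step ^^ T) g) \<le> \<epsilon> * osc \<Omega> g"
    using osc_steps_small[OF assms] by blast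
  have "mixing_dist \<Omega> K T \<le> \<epsilon>"
  proof (rule mixing_dist_le)
    fix A
    have "\<epsilon> * osc \<Omega> (indicator A) \<le> \<epsilon>" using osc_indicator_le assms by simp
    then show "osc \<Omega> ((step ^^ T) (indicator A)) \<le> \<epsilon>" using T order_trans by blast
  qed
  then show ?thesis unfolding mixing_time_def by (rule LeastI)
qed

lemma mixing_time_le:
  "(\<And>A. osc \<Omega> ((step ^^ t) (indicator A)) \<le> \<epsilon>) \<Longrightarrow> mixing_time \<Omega> K \<epsilon> \<le> t"
  unfolding mixing_time_def by (intro Least_le mixing_dist_le)

section \<open>Bottlenecks and the Cheeger constant\<close>

lemma prob_stationary: "S \<subseteq> \<Omega> \<Longrightarrow> measure_pmf.prob \<pi> S = (\<Sum>x\<in>S. pmf \<pi> x)"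
  using finite_states by (intro measure_measure_pmf_finite) (auto intro: finite_subset)

lemma edge_flow_complement:
  assumes "S \<subseteq> \<Omega>"
  shows "edge_flow \<Omega> K S (\<Omega> - S) = (\<Sum>x\<in>S. pmf \<pi> x * step (indicator (\<Omega> - S)) x)"
  unfolding edge_flow_def step_def sum_distrib_left
proof (rule sum.cong[OF refl])
  fix x
  show "(\<Sum>y\<in>\<Omega> - S. pmf \<pi> x * pmf (K x) y)
      = (\<Sum>y\<in>\<Omega>. pmf \<pi> x * (pmf (K x) y * indicator (\<Omega> - S) y))"
    using finite_states by (intro sum.mono_neutral_cong_left) (auto split: split_indicator)
qed

text \<open>
  A stationary chain that is in \<open>S\<close> at time \<open>0\<close> and outside \<open>S\<close> at time \<open>t\<close> crosses from \<open>S\<close>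
  to its complement at one of \<open>t\<close> steps.
\<close>

lemma escape_probability_le:
  assumes "S \<subseteq> \<Omega>"
  shows "(\<Sum>x\<in>S. pmf \<pi> x * (step ^^ t) (indicator (\<Omega> - S)) x) \<le> t * edge_flow \<Omega> K S (\<Omega> - S)"
proof (induction t)
  case 0
  show ?case using assms by (simp add: sum.neutral)
next
  case (Suc t)
  let ?c = "indicator (\<Omega> - S) :: 'a \<Rightarrow> real"
  let ?g = "\<lambda>x. indicator S x * step ?c x"
  have c01: "0 \<le> step ?c x" "step ?c x \<le> 1" if "x \<in> \<Omega>" for x
    using steps_indicator_nonneg[OF that, of 1] step_mono[of ?c "\<lambda>_. 1" x] that
    by (auto split: split_indicator)
  \<comment> \<open>Being outside \<open>S\<close> at time \<open>t + 1\<close> means being outside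
    at time \<open>t\<close>, or being in \<open>S\<close> then and crossing in the last
    step.\<close>
  have "(step ^^ Suc t) ?c x \<le> (step ^^ t) ?g x + (step ^^ t) ?c x" if "x \<in> \<Omega>" for x
  proof -
    have "(step ^^ Suc t) ?c x = (step ^^ t) (step ?c) x" by (simp add: funpow_swap1)
    also have "\<dots> \<le> (step ^^ t) (\<lambda>x. ?g x + ?c x) x"
      using that c01 by (intro steps_mono) (auto split: split_indicator)
    finally show ?thesis by (simp add: steps_add)
  qed
  then have "(\<Sum>x\<in>S. pmf \<pi> x * (step ^^ Suc t) ?c x)
      \<le> (\<Sum>x\<in>S. pmf \<pi> x * ((step ^^ t) ?g x + (step ^^ t) ?c x))"
    using assms by (intro sum_mono mult_left_mono) auto
  also have "\<dots> = (\<Sum>x\<in>S. pmf \<pi> x * (step ^^ t) ?g x) + (\<Sum>x\<in>S. pmf \<pi> x * (step ^^ t) ?c x)"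
    by (simp add: algebra_simps sum.distrib)
  \<comment> \<open>Extending the sum to all states makes stationarity applicable, which removes the
    \<open>t\<close> steps and leaves the flow out of \<open>S\<close>.\<close>
  also have "(\<Sum>x\<in>S. pmf \<pi> x * (step ^^ t) ?g x) \<le> (\<Sum>x\<in>\<Omega>. pmf \<pi> x * (step ^^ t) ?g x)"
    using assms finite_states c01 steps_mono[of "\<lambda>_. 0" ?g]
    by (intro sum_mono2) (auto intro!: mult_nonneg_nonneg)
  also have "\<dots> = (\<Sum>x\<in>\<Omega>. pmf \<pi> x * ?g x)" by (rule sum_stationary_steps)
  also have "\<dots> = edge_flow \<Omega> K S (\<Omega> - S)"
    unfolding edge_flow_complement[OF assms] using assms finite_states
    by (intro sum.mono_neutral_cong_right) (auto split: split_indicator)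
  finally show ?case using Suc by (simp add: algebra_simps)
qed

text \<open>At the mixing time, every start in \<open>S\<close> is outside \<open>S\<close> with
  probability at least 1/2 - 1/4. Averaging over \<open>S\<close> and comparing with the escape
  bound gives the claim.\<close>

lemma mixing_time_bottleneck:
  assumes "S \<subseteq> \<Omega>" "S \<noteq> {}" "measure_pmf.prob \<pi> S \<le> 1 / 2"
  shows "1 / 4 \<le> mixing_time \<Omega> K (1 / 4) * bottleneck_ratio \<Omega> K S"
proof -
  let ?t = "mixing_time \<Omega> K (1 / 4)" and ?c = "indicator (\<Omega> - S) :: 'a \<Rightarrow> real"
  let ?p = "measure_pmf.prob \<pi>"
  have pS: "0 < ?p S"
    using assms finite_states stationary_pmf_pos finite_subset
    by (subst prob_stationary) (auto intro!: sum_pos)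
  have "?p (\<Omega> - S) = 1 - ?p S"
    using assms(1) sum_pmf_eq_1[OF finite_states set_stationary_pmf] finite_states
    by (simp add: prob_stationary sum_diff)
  then have pc: "1 / 2 \<le> ?p (\<Omega> - S)" using assms(3) by simp
  have escape: "1 / 4 \<le> (step ^^ ?t) ?c x" if "x \<in> S" for x
  proof -
    have x: "x \<in> \<Omega>" using that assms(1) by blast
    have "tv_dist (chain_dist K ?t x) \<pi> \<le> mixing_dist \<Omega> K ?t"
      unfolding mixing_dist_def using finite_states x by (intro Max_ge) auto
    then have "\<bar>measure_pmf.prob (chain_dist K ?t x) (\<Omega> - S) - ?p (\<Omega> - S)\<bar> \<le> 1 / 4"
      using mixing_dist_mixing_time[of "1 / 4"] tv_dist_ge[of "chain_dist K ?t x" "\<Omega> - S" \<pi>]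
      by linarith
    then have "\<bar>(step ^^ ?t) ?c x - ?p (\<Omega> - S)\<bar> \<le> 1 / 4" by (simp add: prob_chain_dist[OF x])
    then show ?thesis using pc by linarith
  qed
  have "?p S / 4 = (\<Sum>x\<in>S. pmf \<pi> x * (1 / 4))"
    using assms(1) by (simp add: prob_stationary sum_divide_distrib)
  also have "\<dots> \<le> (\<Sum>x\<in>S. pmf \<pi> x * (step ^^ ?t) ?c x)"
    using escape by (intro sum_mono mult_left_mono) auto
  also have "\<dots> \<le> ?t * edge_flow \<Omega> K S (\<Omega> - S)" by (rule escape_probability_le[OF assms(1)])
  finally show ?thesis using pS by (simp add: bottleneck_ratio_def field_simps)
qed

lemma cheeger_sets_finite: "finite {S. S \<subseteq> \<Omega> \<and> S \<noteq> {} \<and> measure_pmf.prob \<pi> S \<le> 1 / 2}"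
  using finite_states by auto

lemma cheeger_le:
  assumes "S \<subseteq> \<Omega>" "S \<noteq> {}" "measure_pmf.prob \<pi> S \<le> 1 / 2"
  shows "cheeger_constant \<Omega> K \<le> bottleneck_ratio \<Omega> K S"
  unfolding cheeger_constant_def using assms cheeger_sets_finite by (intro Min_le) auto

lemma disjoint_prob_le_half:
  assumes "S \<subseteq> \<Omega>" "S' \<subseteq> \<Omega>" "S \<inter> S' = {}"
  shows "measure_pmf.prob \<pi> S \<le> 1 / 2 \<or> measure_pmf.prob \<pi> S' \<le> 1 / 2"
  using measure_pmf.finite_measure_Union[of S \<pi> S'] assms measure_pmf.prob_le_1[of \<pi> "S \<union> S'"]
  by auto

text \<open>Of two distinct states one has stationary mass at most 1/2, so its singleton is
  admissible. The minimum is then over a nonempty finite family and is attained by some admissible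
  set.\<close>

lemma mixing_time_cheeger:
  assumes "2 \<le> card \<Omega>"
  shows "1 / 4 \<le> mixing_time \<Omega> K (1 / 4) * cheeger_constant \<Omega> K"
proof -
  let ?C = "{S. S \<subseteq> \<Omega> \<and> S \<noteq> {} \<and> measure_pmf.prob \<pi> S \<le> 1 / 2}"
  obtain x y where xy: "x \<in> \<Omega>" "y \<in> \<Omega>" "x \<noteq> y"
    using assms by (metis (no_types, lifting) One_nat_def card_le_Suc0_iff_eq finite_states
        not_less_eq_eq numeral_2_eq_2)
  have "{x} \<in> ?C \<or> {y} \<in> ?C" using disjoint_prob_le_half[of "{x}" "{y}"] xy by auto
  then have "?C \<noteq> {}" by blast
  then have "cheeger_constant \<Omega> K \<in> bottleneck_ratio \<Omega> K ` ?C"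
    unfolding cheeger_constant_def using cheeger_sets_finite by (intro Min_in) auto
  then show ?thesis
    using mixing_time_bottleneck by (elim imageE) (simp only: mem_Collect_eq, blast)
qed

text \<open>
  Negative drift of \<open>f\<close> makes \<open>exp (\<theta> f)\<close> a supermartingale on \<open>a \<le> f < b\<close> for small \<open>\<theta>\<close>.
  Stationarity of its truncation at level \<open>b\<close> bounds the stationary mass near that level.
\<close>

lemma bottleneck_ratio_drift_le:
  fixes f :: "'a \<Rightarrow> real"
  assumes W: "1 \<le> W" "\<And>x y. x \<in> \<Omega> \<Longrightarrow> y \<in> set_pmf (K x) \<Longrightarrow> \<bar>f y - f x\<bar> \<le> W"
    and \<kappa>: "0 < \<kappa>" "\<kappa> \<le> 1"
    and drift: "\<And>x. x \<in> \<Omega> \<Longrightarrow> a \<le> f x \<Longrightarrow> f x < b \<Longrightarrow> step (\<lambda>y. f y - f x) x \<le> - \<kappa>"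
    and ab: "a \<le> b - W"
    and \<theta>: "\<theta> = \<kappa> / (2 * W\<^sup>2)"
  shows "bottleneck_ratio \<Omega> K {x\<in>\<Omega>. f x < b} \<le> 2 / (\<theta> * \<kappa>) * exp (- \<theta> * (b - a - 2 * W))"
proof -
  define S where "S = {x\<in>\<Omega>. f x < b}"
  define h where "h x = min (exp (\<theta> * f x)) (exp (\<theta> * b))" for x
  define B where "B = {x\<in>\<Omega>. a \<le> f x \<and> f x < b}"
  have sub: "S \<subseteq> \<Omega>" "B \<subseteq> S" by (auto simp: S_def B_def)
  have fin: "finite S" "finite B" using finite_subset[OF sub(1) finite_states] finite_subset[OF sub(2)] by auto
  have \<theta>_pos: "0 < \<theta>" using \<theta> \<kappa> W by simp
  have "\<kappa> \<le> 2 * W" using \<kappa> W by simp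
  then have \<theta>W: "\<theta> * W \<le> 1" using W by (simp add: \<theta> power2_eq_square field_simps)
  \<comment> \<open>The choice of \<theta> makes the second-order term exactly half of the
    first-order gain \<theta> \<kappa>, so half of the drift survives in the band.\<close>
  have \<theta>W2: "\<theta>\<^sup>2 * W\<^sup>2 = \<theta> * \<kappa> / 2" using W by (simp add: \<theta> power2_eq_square field_simps)
  have pS_nonneg: "0 \<le> measure_pmf.prob \<pi> S" by simp
  have band: "step h x - h x \<le> - (\<theta> * \<kappa> / 2) * h x" if x: "x \<in> B" for x
  proof -
    have x': "x \<in> \<Omega>" "a \<le> f x" "f x < b" using x by (auto simp: B_def)
    have hx: "h x = exp (\<theta> * f x)" using x' \<theta>_pos by (simp add: h_def)
    have "step h x \<le> step (\<lambda>y. exp (\<theta> * f x) * (1 + \<theta> * (f y - f x) + \<theta>\<^sup>2 * W\<^sup>2)) x"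
      unfolding step_def
    proof (intro sum_mono)
      fix y assume "y \<in> \<Omega>"
      show "pmf (K x) y * h y \<le> pmf (K x) y * (exp (\<theta> * f x) * (1 + \<theta> * (f y - f x) + \<theta>\<^sup>2 * W\<^sup>2))"
      proof (cases "y \<in> set_pmf (K x)")
        case True
        let ?u = "\<theta> * (f y - f x)"
        have d: "\<bar>f y - f x\<bar> \<le> W" using W(2) True x' by blast
        then have "\<bar>?u\<bar> \<le> \<theta> * W" using \<theta>_pos by (simp add: abs_mult mult_left_mono)
        then have u: "\<bar>?u\<bar> \<le> 1" using \<theta>W by linarith
        have "exp ?u \<le> 1 + ?u + ?u\<^sup>2" by (rule exp_le_quadratic[OF u])
        also have "?u\<^sup>2 \<le> \<theta>\<^sup>2 * W\<^sup>2"
          using d by (simp add: power_mult_distrib mult_left_mono abs_le_square_iff[symmetric])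
        finally have "exp ?u \<le> 1 + ?u + \<theta>\<^sup>2 * W\<^sup>2" by simp
        then have "exp (\<theta> * f x) * exp ?u \<le> exp (\<theta> * f x) * (1 + ?u + \<theta>\<^sup>2 * W\<^sup>2)"
          by (intro mult_left_mono) auto
        moreover have "exp (\<theta> * f x) * exp ?u = exp (\<theta> * f y)"
          by (simp add: right_diff_distrib flip: exp_add)
        then have "h y \<le> exp (\<theta> * f x) * exp ?u" by (simp add: h_def)
        ultimately have "h y \<le> exp (\<theta> * f x) * (1 + ?u + \<theta>\<^sup>2 * W\<^sup>2)" by linarith
        then show ?thesis by (intro mult_left_mono) auto
      qed (simp add: set_pmf_iff)
    qed
    also have "\<dots> = h x * (1 + \<theta> * step (\<lambda>y. f y - f x) x + \<theta>\<^sup>2 * W\<^sup>2)"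
      unfolding step_cmult step_add hx using x'(1) by simp
    also have "\<dots> \<le> h x * (1 + \<theta> * - \<kappa> + \<theta>\<^sup>2 * W\<^sup>2)"
      using drift[OF x'] \<theta>_pos by (intro mult_left_mono add_mono) (auto simp: hx)
    finally show ?thesis unfolding \<theta>W2 by (simp add: field_simps)
  qed
  \<comment> \<open>From below level \<open>a\<close> one step reaches at most
    \<open>a + W\<close>.\<close>
  have low: "step h x - h x \<le> exp (\<theta> * (a + W))" if x: "x \<in> S - B" for x
  proof -
    have x': "x \<in> \<Omega>" "f x < a" using x by (auto simp: S_def B_def)
    have "step h x \<le> step (\<lambda>_. exp (\<theta> * (a + W))) x"
      unfolding step_def
    proof (intro sum_mono)
      fix y assume "y \<in> \<Omega>"
      show "pmf (K x) y * h y \<le> pmf (K x) y * exp (\<theta> * (a + W))"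
      proof (cases "y \<in> set_pmf (K x)")
        case True
        have "f y \<le> a + W" using W(2)[OF x'(1) True] x'(2) by linarith
        then have "h y \<le> exp (\<theta> * (a + W))" using \<theta>_pos by (simp add: h_def min.coboundedI1)
        then show ?thesis by (intro mult_left_mono) auto
      qed (simp add: set_pmf_iff)
    qed
    moreover have "0 \<le> h x" by (simp add: h_def)
    ultimately show ?thesis using x' by simp
  qed
  have high: "step h x - h x \<le> 0" if x: "x \<in> \<Omega> - S" for x
  proof -
    have "h x = exp (\<theta> * b)" using x \<theta>_pos by (auto simp: S_def h_def min_def)
    moreover have "step h x \<le> step (\<lambda>_. exp (\<theta> * b)) x" by (intro step_mono) (simp add: h_def)
    ultimately show ?thesis using x by simp
  qed
  \<comment> \<open>Under \<pi> the mean increment of \<open>h\<close> vanishes, so the loss in the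
    band is paid for by the gain below it. This bounds the weighted mass of the band.\<close>
  have "0 = (\<Sum>x\<in>\<Omega>. pmf \<pi> x * (step h x - h x))"
    using sum_stationary_steps[of 1 h] by (simp add: right_diff_distrib sum_subtractf)
  also have "\<dots> = (\<Sum>x\<in>\<Omega> - S. pmf \<pi> x * (step h x - h x)) + (\<Sum>x\<in>S - B. pmf \<pi> x * (step h x - h x))
      + (\<Sum>x\<in>B. pmf \<pi> x * (step h x - h x))"
    unfolding sum.subset_diff[OF sub(1) finite_states] sum.subset_diff[OF sub(2) fin(1)] by simp
  also have "\<dots> \<le> (\<Sum>x\<in>\<Omega> - S. 0) + (\<Sum>x\<in>S - B. pmf \<pi> x * exp (\<theta> * (a + W)))
      + (\<Sum>x\<in>B. pmf \<pi> x * (- (\<theta> * \<kappa> / 2) * h x))"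
    using band low high
    by (intro add_mono sum_mono mult_left_mono) (auto intro: mult_nonneg_nonpos)
  finally have "\<theta> * \<kappa> / 2 * (\<Sum>x\<in>B. pmf \<pi> x * h x) \<le> (\<Sum>x\<in>S - B. pmf \<pi> x) * exp (\<theta> * (a + W))"
    by (simp add: sum_distrib_left sum_distrib_right sum_negf mult_ac)
  also have "\<dots> \<le> measure_pmf.prob \<pi> S * exp (\<theta> * (a + W))"
    using fin sub by (auto simp: prob_stationary intro!: mult_right_mono sum_mono2)
  finally have mass: "\<theta> * \<kappa> / 2 * (\<Sum>x\<in>B. pmf \<pi> x * h x) \<le> measure_pmf.prob \<pi> S * exp (\<theta> * (a + W))" .
  let ?F = "edge_flow \<Omega> K S (\<Omega> - S)"
  have "exp (\<theta> * (b - W)) * ?F = (\<Sum>x\<in>S. pmf \<pi> x * (exp (\<theta> * (b - W)) * step (indicator (\<Omega> - S)) x))"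
    unfolding edge_flow_complement[OF sub(1)] by (simp add: sum_distrib_left mult_ac)
  \<comment> \<open>Only states with \<open>f\<close> at least \<open>b - W\<close> can leave
    \<open>S\<close> in one step. They belong to the band, and \<open>h\<close> is at least
    \<open>exp (\<theta> * (b - W))\<close> there.\<close>
  also have "\<dots> \<le> (\<Sum>x\<in>S. pmf \<pi> x * (indicator B x * h x))"
  proof (intro sum_mono mult_left_mono)
    fix x assume x: "x \<in> S"
    then have x': "x \<in> \<Omega>" using sub by blast
    show "exp (\<theta> * (b - W)) * step (indicator (\<Omega> - S)) x \<le> indicator B x * h x"
    proof (cases "b - W \<le> f x")
      case True
      then have "x \<in> B" using x ab by (auto simp: B_def S_def)
      have "step (indicator (\<Omega> - S)) x \<le> step (\<lambda>_. 1) x"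
        by (intro step_mono) (simp add: indicator_def)
      then have "exp (\<theta> * (b - W)) * step (indicator (\<Omega> - S)) x \<le> exp (\<theta> * (b - W)) * 1"
        using x' by (intro mult_left_mono) auto
      also have "\<dots> \<le> h x" using True \<theta>_pos W by (simp add: h_def)
      finally show ?thesis using \<open>x \<in> B\<close> by simp
    next
      case False
      have "pmf (K x) y * indicator (\<Omega> - S) y = 0" for y
      proof (cases "y \<in> set_pmf (K x)")
        case True
        then have "f y < b" using W(2)[OF x' True] False by linarith
        then show ?thesis by (auto simp: S_def)
      qed (simp add: set_pmf_iff)
      then have "step (indicator (\<Omega> - S)) x = 0" by (simp only: step_def sum.neutral_const)
      then show ?thesis by (simp add: h_def)
    qed
  qed auto
  also have "\<dots> = (\<Sum>x\<in>B. pmf \<pi> x * h x)"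
    using sub fin by (intro sum.mono_neutral_cong_right) (auto split: split_indicator)
  finally have flow: "exp (\<theta> * (b - W)) * ?F \<le> (\<Sum>x\<in>B. pmf \<pi> x * h x)" .
  have "\<theta> * \<kappa> / 2 * (exp (\<theta> * (b - W)) * ?F) \<le> \<theta> * \<kappa> / 2 * (\<Sum>x\<in>B. pmf \<pi> x * h x)"
    using flow \<theta>_pos \<kappa> by (intro mult_left_mono) auto
  with mass have "\<theta> * \<kappa> / 2 * (exp (\<theta> * (b - W)) * ?F) \<le> measure_pmf.prob \<pi> S * exp (\<theta> * (a + W))"
    by linarith
  then have "?F \<le> measure_pmf.prob \<pi> S * exp (\<theta> * (a + W)) / (\<theta> * \<kappa> / 2 * exp (\<theta> * (b - W)))"
    using \<theta>_pos \<kappa> by (subst pos_le_divide_eq) (simp_all add: mult_ac)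
  then have "?F \<le> measure_pmf.prob \<pi> S * (2 / (\<theta> * \<kappa>) * (exp (\<theta> * (a + W)) / exp (\<theta> * (b - W))))"
    by (simp add: mult_ac)
  also have "exp (\<theta> * (a + W)) / exp (\<theta> * (b - W)) = exp (- \<theta> * (b - a - 2 * W))"
    by (simp add: algebra_simps flip: exp_diff)
  finally have F: "?F \<le> measure_pmf.prob \<pi> S * (2 / (\<theta> * \<kappa>) * exp (- \<theta> * (b - a - 2 * W)))" .
  have "bottleneck_ratio \<Omega> K S \<le> 2 / (\<theta> * \<kappa>) * exp (- \<theta> * (b - a - 2 * W))"
  proof (cases "measure_pmf.prob \<pi> S = 0")
    \<comment> \<open>Division by zero makes the ratio 0 in this case.\<close>
    case True
    then show ?thesis using \<theta>_pos \<kappa> by (simp add: bottleneck_ratio_def)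
  next
    case False
    then have "0 < measure_pmf.prob \<pi> S" using pS_nonneg by linarith
    then show ?thesis
      using F unfolding bottleneck_ratio_def by (subst pos_divide_le_eq) (simp_all add: mult.commute)
  qed
  then show ?thesis by (simp add: S_def)
qed

end

section \<open>Cumulative oscillation and perturbation of jump probabilities\<close>

context finite_chain
begin

definition cum_osc :: "nat \<Rightarrow> ('s \<Rightarrow> real) \<Rightarrow> real" where
  "cum_osc T g = (\<Sum>s<T. osc \<Omega> ((step ^^ s) g))"

lemma cum_osc_nonneg: "0 \<le> cum_osc T g"
  unfolding cum_osc_def by (intro sum_nonneg osc_nonneg finite_states states_nonempty)

lemma osc_le_cum_osc: "1 \<le> T \<Longrightarrow> osc \<Omega> g \<le> cum_osc T g"
  unfolding cum_osc_def
  using member_le_sum[of 0 "{..<T}" "\<lambda>s. osc \<Omega> ((step ^^ s) g)"]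
    osc_nonneg[OF finite_states states_nonempty] by simp

lemma cum_osc_le: "cum_osc T g \<le> real T * osc \<Omega> g"
  unfolding cum_osc_def using sum_mono[of "{..<T}" _ "\<lambda>_. osc \<Omega> g"] osc_steps_le by simp

lemma cum_osc_add_le: "cum_osc T (\<lambda>x. f x + g x) \<le> cum_osc T f + cum_osc T g"
  unfolding cum_osc_def steps_add sum.distrib[symmetric]
  by (intro sum_mono osc_add_le finite_states states_nonempty)

lemma cum_osc_cmult_le: "0 \<le> c \<Longrightarrow> cum_osc T (\<lambda>x. c * f x) \<le> c * cum_osc T f"
  unfolding cum_osc_def steps_cmult sum_distrib_left
  by (intro sum_mono osc_cmult_le finite_states states_nonempty)

lemma cum_osc_zero: "cum_osc T (\<lambda>_. 0) \<le> 0"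
  using cum_osc_le[of T "\<lambda>_. 0"] osc_le_bound[OF finite_states states_nonempty, of "\<lambda>_. 0" 0]
  by (smt (verit, best) mult_nonneg_nonpos of_nat_0_le_iff)

lemma cum_osc_sum_le:
  assumes "finite A" "\<And>l. l \<in> A \<Longrightarrow> 0 \<le> a l"
  shows "cum_osc T (\<lambda>x. \<Sum>l\<in>A. a l * g l x) \<le> (\<Sum>l\<in>A. a l * cum_osc T (g l))"
  using assms
proof (induction A rule: finite_induct)
  case (insert l A)
  have "cum_osc T (\<lambda>x. a l * g l x + (\<Sum>l\<in>A. a l * g l x))
      \<le> a l * cum_osc T (g l) + (\<Sum>l\<in>A. a l * cum_osc T (g l))"
    using insert.IH insert.prems
    by (intro order_trans[OF cum_osc_add_le] add_mono cum_osc_cmult_le) auto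
  then show ?case using insert.hyps by simp
qed (simp add: cum_osc_zero)

text \<open>Applying \<open>step\<close> shifts the sum by one time unit. The lost first term is
  \<open>osc \<Omega> g\<close>, the new last term is at most half of it, and
  \<open>osc \<Omega> g\<close> is at least \<open>cum_osc T g / T\<close>.\<close>

lemma cum_osc_step:
  assumes "1 \<le> T" "osc \<Omega> ((step ^^ T) g) \<le> osc \<Omega> g / 2"
  shows "cum_osc T (step g) \<le> (1 - 1 / (2 * real T)) * cum_osc T g"
proof -
  have "cum_osc T (step g) = (\<Sum>s<T. osc \<Omega> ((step ^^ Suc s) g))"
    by (simp add: cum_osc_def funpow_swap1)
  also have "\<dots> = (\<Sum>s<Suc T. osc \<Omega> ((step ^^ s) g)) - osc \<Omega> g"
    by (subst sum.lessThan_Suc_shift) simp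
  also have "\<dots> = cum_osc T g + osc \<Omega> ((step ^^ T) g) - osc \<Omega> g" by (simp add: cum_osc_def)
  also have "\<dots> \<le> cum_osc T g - osc \<Omega> g / 2" using assms(2) by linarith
  also have "\<dots> \<le> cum_osc T g - cum_osc T g / (2 * real T)"
    using cum_osc_le[of T g] assms(1) by (simp add: field_simps)
  finally show ?thesis by (simp add: algebra_simps)
qed

text \<open>Equal total masses allow \<open>g\<close> to be recentred at one of its values, after
  which every factor is bounded by the oscillation.\<close>

lemma averaged_difference_le:
  fixes a b :: "'s \<Rightarrow> real"
  assumes "sum a \<Omega> = sum b \<Omega>"
  shows "\<bar>(\<Sum>j\<in>\<Omega>. a j * g j) - (\<Sum>j\<in>\<Omega>. b j * g j)\<bar> \<le> (\<Sum>j\<in>\<Omega>. \<bar>a j - b j\<bar>) * osc \<Omega> g"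
proof -
  obtain c where c: "c \<in> \<Omega>" using states_nonempty by blast
  have "(\<Sum>j\<in>\<Omega>. a j * g j) - (\<Sum>j\<in>\<Omega>. b j * g j) = (\<Sum>j\<in>\<Omega>. (a j - b j) * (g j - g c))"
    using assms by (simp add: algebra_simps sum_subtractf sum.distrib flip: sum_distrib_right)
  also have "\<bar>\<dots>\<bar> \<le> (\<Sum>j\<in>\<Omega>. \<bar>a j - b j\<bar> * osc \<Omega> g)"
    using osc_abs_ge[OF finite_states _ c, of _ g]
    by (intro order_trans[OF sum_abs] sum_mono) (auto simp: abs_mult intro!: mult_left_mono)
  finally show ?thesis by (simp add: sum_distrib_right)
qed

end

text \<open>The total also grows by a factor between 1 and \<open>c\<close>, so each normalized
  weight changes by a factor between 1/c and c. Since 1 - 1/c \<le> c - 1, the change is at most c -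
  1 times the old normalized weight, and these add up to 1.\<close>

lemma normalized_weights_diff_le:
  fixes u u' :: "'s \<Rightarrow> real"
  assumes "finite A" "A \<noteq> {}"
    and u: "\<And>m. m \<in> A \<Longrightarrow> 0 < u m" "\<And>m. m \<in> A \<Longrightarrow> u m \<le> u' m" "\<And>m. m \<in> A \<Longrightarrow> u' m \<le> c * u m"
    and c: "1 \<le> c"
  shows "(\<Sum>m\<in>A. \<bar>u' m / sum u' A - u m / sum u A\<bar>) \<le> c - 1"
proof -
  let ?U = "sum u A" and ?U' = "sum u' A"
  have U: "0 < ?U" using assms(1,2) u(1) by (intro sum_pos)
  have UU': "?U \<le> ?U'" using u(2) by (intro sum_mono)
  have U'U: "?U' \<le> c * ?U" unfolding sum_distrib_left using u(3) by (intro sum_mono)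
  have "\<bar>u' m / ?U' - u m / ?U\<bar> \<le> (c - 1) * (u m / ?U)" if m: "m \<in> A" for m
  proof -
    have "u' m / ?U' \<le> c * u m / ?U"
      using u[OF m] U UU' c by (intro frac_le) auto
    moreover have "u m / (c * ?U) \<le> u' m / ?U'"
      using u[OF m] U UU' U'U c by (intro frac_le) auto
    moreover have "u m / ?U - u m / (c * ?U) \<le> (c - 1) * (u m / ?U)"
    proof -
      have "1 - 1 / c \<le> c - 1"
        using c sum_squares_ge_zero[of "c - 1" 0] by (simp add: field_simps)
      then have "(1 - 1 / c) * (u m / ?U) \<le> (c - 1) * (u m / ?U)"
        using u(1)[OF m] U by (intro mult_right_mono) auto
      then show ?thesis by (simp add: left_diff_distrib diff_divide_distrib)
    qed
    ultimately show ?thesis by (simp add: left_diff_distrib diff_divide_distrib abs_le_iff)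
  qed
  then have "(\<Sum>m\<in>A. \<bar>u' m / ?U' - u m / ?U\<bar>) \<le> (\<Sum>m\<in>A. (c - 1) * (u m / ?U))"
    by (rule sum_mono)
  also have "\<dots> = c - 1" using U by (simp flip: sum_distrib_left sum_divide_distrib)
  finally show ?thesis .
qed

section \<open>The attracting random walks chain\<close>

text \<open>Used to view a configuration of \<open>n\<close> particles as \<open>n - 1\<close> given
  ones together with one distinguished particle.\<close>

definition add_particle :: "('a \<Rightarrow> nat) \<Rightarrow> 'a \<Rightarrow> 'a \<Rightarrow> nat" where
  "add_particle z i = z(i := z i + 1)"

locale arw = graph G for G :: "('a, 'b) pre_digraph" (structure) +
  assumes conn: "Digraph_Component.connected G"
    and card_verts: "2 \<le> card (verts G)"
begin

lemma graph_G: "graph G" by unfold_locales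

text \<open>Arcs are symmetric, so connectedness of the underlying undirected graph already gives
  directed walks.\<close>

lemma reach: "u \<in> verts G \<Longrightarrow> v \<in> verts G \<Longrightarrow> u \<rightarrow>\<^sup>* v"
  using conn reachable_mk_symmetric_eq[OF sym_arcs]
  by (auto simp: Digraph_Component.connected_def strongly_connected_def)

lemma neighbor_in_verts: "j \<in> neighbors G i \<Longrightarrow> i \<in> verts G \<and> j \<in> verts G"
  by (auto simp: neighbors_def adj_in_verts)

lemma neighbor_sym: "j \<in> neighbors G i \<Longrightarrow> i \<in> neighbors G j"
  using sym_arcs by (auto simp: neighbors_def symmetric_def sym_def)

lemma set_arw_jump: "set_pmf (arw_jump G n \<beta> x i) = insert i (neighbors G i)"
  using arw_Z_pos[OF graph_G, of n \<beta> x i]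
  by (auto simp: set_pmf_iff pmf_arw_jump[OF graph_G] arw_weight_def split: if_splits)

lemma set_arw_jump_subset: "i \<in> verts G \<Longrightarrow> set_pmf (arw_jump G n \<beta> x i) \<subseteq> verts G"
  using neighbor_in_verts by (auto simp: set_arw_jump)

lemma sum_pmf_arw_jump: "i \<in> verts G \<Longrightarrow> (\<Sum>j\<in>verts G. pmf (arw_jump G n \<beta> x i) j) = 1"
  by (intro sum_pmf_eq_1 finite_verts set_arw_jump_subset)

lemma arw_Z_eq_sum: "arw_Z G n \<beta> x i = sum (arw_weight n \<beta> x i) (insert i (neighbors G i))"
  using finite_neighbors[OF graph_G] not_self_neighbor[OF graph_G] by (simp add: arw_Z_def)

lemma states_pos:
  assumes "x \<in> arw_states G n" "1 \<le> n"
  obtains i where "i \<in> verts G" "1 \<le> x i"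
proof -
  have "(\<Sum>i\<in>verts G. x i) \<noteq> 0" using assms by (simp add: arw_states_def)
  then show ?thesis using that by (metis One_nat_def Suc_leI bot_nat_0.not_eq_extremum sum.neutral)
qed

lemma add_particle_in_states: "z \<in> arw_states G m \<Longrightarrow> i \<in> verts G \<Longrightarrow> add_particle z i \<in> arw_states G (Suc m)"
proof -
  assume z: "z \<in> arw_states G m" and i: "i \<in> verts G"
  have "(\<Sum>l\<in>verts G. add_particle z i l) = (\<Sum>l\<in>verts G. z l + (if l = i then 1 else 0))"
    by (intro sum.cong) (auto simp: add_particle_def)
  also have "\<dots> = Suc m" using z i by (simp add: sum.distrib arw_states_def)
  finally show ?thesis using z i by (auto simp: arw_states_def add_particle_def)
qed

lemma states_decompose:
  assumes "x \<in> arw_states G (Suc m)" "1 \<le> x i"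
  shows "i \<in> verts G" "x(i := x i - 1) \<in> arw_states G m" "x = add_particle (x(i := x i - 1)) i"
proof -
  show i: "i \<in> verts G" using assms by (auto simp: arw_states_def)
  show eq: "x = add_particle (x(i := x i - 1)) i" using assms(2) by (auto simp: add_particle_def)
  have "(\<Sum>l\<in>verts G. x l) = (\<Sum>l\<in>verts G. (x(i := x i - 1)) l + (if l = i then 1 else 0))"
    using assms(2) by (intro sum.cong) auto
  also have "\<dots> = (\<Sum>l\<in>verts G. (x(i := x i - 1)) l) + 1" using i by (simp add: sum.distrib del: fun_upd_apply)
  finally show "x(i := x i - 1) \<in> arw_states G m" using assms by (auto simp: arw_states_def)
qed

section \<open>The chain on configurations and its ergodicity\<close>

lemma finite_chain_arw:
  assumes "1 \<le> n"
  shows "finite_chain (arw_states G n) (arw_kernel G n \<beta>)"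
proof
  obtain v where v: "v \<in> verts G" using card_verts by fastforce
  have "(\<lambda>i. if i = v then n else 0) \<in> arw_states G n" using v by (auto simp: arw_states_def)
  then show "arw_states G n \<noteq> {}" by blast
qed (use assms finite_arw_states[OF finite_verts] set_arw_kernel[OF graph_G _ assms] in auto)

lemma set_arw_pick: "x \<in> arw_states G n \<Longrightarrow> 1 \<le> n \<Longrightarrow> set_pmf (arw_pick G x) = {i. 1 \<le> x i}"
  using pmf_arw_pick[OF finite_verts] by (auto simp: set_pmf_iff)

lemma step_arw:
  assumes "x \<in> arw_states G n" "1 \<le> n"
  shows "finite_chain.step (arw_states G n) (arw_kernel G n \<beta>) f x =
    (\<Sum>i\<in>verts G. x i / n * (\<Sum>j\<in>verts G. pmf (arw_jump G n \<beta> x i) j * f (move_particle x i j)))"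
proof -
  interpret finite_chain "arw_states G n" "arw_kernel G n \<beta>" by (rule finite_chain_arw[OF assms(2)])
  let ?J = "\<lambda>i. bind_pmf (arw_jump G n \<beta> x i) (\<lambda>j. return_pmf (move_particle x i j))"
  have fin: "finite (set_pmf (?J i))" for i
    using finite_neighbors[OF graph_G] by (simp add: set_arw_jump)
  have J: "measure_pmf.expectation (?J i) f
      = (\<Sum>j\<in>verts G. pmf (arw_jump G n \<beta> x i) j * f (move_particle x i j))"
    if "i \<in> verts G" for i
    using set_arw_jump_subset[OF that]
    by (subst pmf_expectation_bind[where A = "verts G"]) auto
  have "step f x = measure_pmf.expectation (bind_pmf (arw_pick G x) ?J) f"
    by (simp add: step_eq_expectation[OF assms(1)] arw_kernel_def)
  also have "\<dots> = (\<Sum>i\<in>verts G. pmf (arw_pick G x) i *\<^sub>R measure_pmf.expectation (?J i) f)"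
    using fin assms by (intro pmf_expectation_bind) (auto simp: set_arw_pick arw_states_def)
  also have "\<dots> = (\<Sum>i\<in>verts G. x i / n * (\<Sum>j\<in>verts G. pmf (arw_jump G n \<beta> x i) j * f (move_particle x i j)))"
    by (intro sum.cong) (simp_all add: J pmf_arw_pick[OF finite_verts assms])
  finally show ?thesis .
qed

lemma arw_kernel_pos:
  assumes "x \<in> arw_states G n" "1 \<le> n" "1 \<le> x i" "j \<in> insert i (neighbors G i)"
  shows "0 < pmf (arw_kernel G n \<beta> x) (move_particle x i j)"
  using assms by (intro pmf_positive) (auto simp: arw_kernel_def set_arw_pick set_arw_jump)

lemma move_particle_self: "1 \<le> x i \<Longrightarrow> move_particle x i i = x"
  by (auto simp: move_particle_def)

lemma move_particle_move: "1 \<le> x i \<Longrightarrow> move_particle (move_particle x i j) j m = move_particle x i m"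
  by (auto simp: move_particle_def Let_def)

text \<open>One particle is carried along a walk from \<open>i\<close> to \<open>j\<close> by
  selecting it again at each step; successive moves compose to a single one by
  \<open>move_particle_move\<close>.\<close>

lemma kernel_reaches_move:
  assumes "x \<in> arw_states G n" "1 \<le> n" "1 \<le> x i" "i \<in> verts G" "j \<in> verts G"
  shows "(\<lambda>x y. 0 < pmf (arw_kernel G n \<beta> x) y)\<^sup>*\<^sup>* x (move_particle x i j)"
  using reach[OF assms(4,5)]
proof (induction rule: reachable_induct)
  case base
  then show ?case by (simp add: move_particle_self[of x i, OF assms(3)])
next
  case (step j m)
  let ?y = "move_particle x i j"
  have j: "j \<in> verts G" using step.hyps by (simp add: adj_in_verts)
  have "?y \<in> arw_states G n" using move_particle_in_states[OF graph_G assms(1,4,3) j] .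
  moreover have "1 \<le> ?y j" by (simp add: move_particle_def)
  moreover have "m \<in> neighbors G j" using step.hyps by (simp add: neighbors_def)
  ultimately have "0 < pmf (arw_kernel G n \<beta> ?y) (move_particle ?y j m)"
    using assms(2) by (intro arw_kernel_pos) auto
  then show ?case
    using step.IH by (simp add: move_particle_move[of x i, OF assms(3)] rtranclp.rtrancl_into_rtrancl)
qed

text \<open>Induction on the number of particles away from \<open>v\<close>: one of them can be
  carried to \<open>v\<close>, and carried back again. Irreducibility follows by passing through the
  concentrated configuration.\<close>

lemma kernel_connects_to_concentrated:
  fixes \<beta> :: real
  assumes "x \<in> arw_states G n" "1 \<le> n" "v \<in> verts G"
  defines "R \<equiv> \<lambda>x y. 0 < pmf (arw_kernel G n \<beta> x) y" and "c \<equiv> \<lambda>i. if i = v then n else 0"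
  shows "R\<^sup>*\<^sup>* x c \<and> R\<^sup>*\<^sup>* c x"
  using assms(1)
proof (induction "n - x v" arbitrary: x rule: less_induct)
  case less
  have sum: "(\<Sum>i\<in>verts G. x i) = x v + (\<Sum>i\<in>verts G - {v}. x i)"
    using assms(3) by (simp add: sum.remove)
  show ?case
  proof (cases "\<exists>i\<in>verts G - {v}. 1 \<le> x i")
    case True
    then obtain i where i: "i \<in> verts G" "i \<noteq> v" "1 \<le> x i" by blast
    let ?y = "move_particle x i v"
    have y: "?y \<in> arw_states G n" "1 \<le> ?y v" "?y v = x v + 1"
      using move_particle_in_states[OF graph_G less.prems i(1,3) assms(3)] i(2)
      by (auto simp: move_particle_def)
    have "x i \<le> (\<Sum>i\<in>verts G - {v}. x i)" using i by (intro member_le_sum) auto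
    moreover have "(\<Sum>i\<in>verts G. x i) = n" using less.prems by (simp add: arw_states_def)
    ultimately have "n - ?y v < n - x v" using sum i(3) y(3) by linarith
    then have IH: "R\<^sup>*\<^sup>* ?y c \<and> R\<^sup>*\<^sup>* c ?y" using less.hyps y(1) by blast
    have "R\<^sup>*\<^sup>* x ?y"
      unfolding R_def by (rule kernel_reaches_move[OF less.prems assms(2) i(3,1) assms(3)])
    moreover have "R\<^sup>*\<^sup>* ?y x"
      using kernel_reaches_move[OF y(1) assms(2) y(2) assms(3) i(1), of \<beta>]
      by (simp add: R_def move_particle_move[of x i v, OF i(3)] move_particle_self[of x i, OF i(3)])
    ultimately show ?thesis using IH by (meson rtranclp_trans)
  next
    case False
    then have 0: "x i = 0" if "i \<noteq> v" for i
      using that False less.prems by (cases "i \<in> verts G") (auto simp: arw_states_def not_less_eq_eq)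
    then have "x v = n" using sum less.prems by (simp add: arw_states_def)
    then have "x = c" using 0 by (auto simp: c_def)
    then show ?thesis by simp
  qed
qed

lemma ergodic_chain_arw:
  assumes "1 \<le> n"
  shows "ergodic_chain (arw_states G n) (arw_kernel G n \<beta>)"
proof -
  interpret finite_chain "arw_states G n" "arw_kernel G n \<beta>" by (rule finite_chain_arw[OF assms])
  show ?thesis
  proof
    fix x assume x: "x \<in> arw_states G n"
    obtain i where i: "i \<in> verts G" "1 \<le> x i" using states_pos[OF x assms] .
    show "0 < pmf (arw_kernel G n \<beta> x) x"
      using arw_kernel_pos[OF x assms i(2), of i] move_particle_self[of x i, OF i(2)] by simp
    fix y assume y: "y \<in> arw_states G n"
    show "(\<lambda>x y. 0 < pmf (arw_kernel G n \<beta> x) y)\<^sup>*\<^sup>* x y"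
      using kernel_connects_to_concentrated[OF x assms i(1), of \<beta>]
        kernel_connects_to_concentrated[OF y assms i(1), of \<beta>] by (meson rtranclp_trans)
  qed
qed

text \<open>With the configuration frozen, the jump kernel is itself a chain on the vertices. At
  \<beta> = 0 it moves uniformly within the closed neighborhood.\<close>

lemma ergodic_chain_walk: "ergodic_chain (verts G) (arw_jump G n \<beta> x)"
proof
  show "verts G \<noteq> {}" using card_verts by auto
  show "set_pmf (arw_jump G n \<beta> x i) \<subseteq> verts G" if "i \<in> verts G" for i
    by (rule set_arw_jump_subset[OF that])
  show "0 < pmf (arw_jump G n \<beta> x i) i" for i
    by (intro pmf_positive) (simp add: set_arw_jump)
  show "(\<lambda>i j. 0 < pmf (arw_jump G n \<beta> x i) j)\<^sup>*\<^sup>* i j" if "i \<in> verts G" "j \<in> verts G" for i j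
    using reach[OF that]
  proof (induction rule: reachable_induct)
    case (step j m)
    have "0 < pmf (arw_jump G n \<beta> x j) m"
      using step.hyps by (intro pmf_positive) (simp add: set_arw_jump neighbors_def)
    then show ?case using step.IH by (rule rtranclp.rtrancl_into_rtrancl[rotated])
  qed simp
qed simp

section \<open>Fast mixing at high temperature\<close>

lemma jump_perturbation_le:
  assumes "i \<in> verts G" "1 \<le> c"
    and "\<And>j. j \<in> insert i (neighbors G i) \<Longrightarrow> arw_weight n \<beta> x i j \<le> arw_weight n' \<beta>' x' i j"
    and "\<And>j. j \<in> insert i (neighbors G i) \<Longrightarrow> arw_weight n' \<beta>' x' i j \<le> c * arw_weight n \<beta> x i j"
  shows "(\<Sum>j\<in>verts G. \<bar>pmf (arw_jump G n' \<beta>' x' i) j - pmf (arw_jump G n \<beta> x i) j\<bar>) \<le> c - 1"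
proof -
  let ?A = "insert i (neighbors G i)"
  have "?A \<subseteq> verts G" using assms(1) neighbor_in_verts by auto
  then have "(\<Sum>j\<in>verts G. \<bar>pmf (arw_jump G n' \<beta>' x' i) j - pmf (arw_jump G n \<beta> x i) j\<bar>)
      = (\<Sum>j\<in>?A. \<bar>arw_weight n' \<beta>' x' i j / sum (arw_weight n' \<beta>' x' i) ?A
          - arw_weight n \<beta> x i j / sum (arw_weight n \<beta> x i) ?A\<bar>)"
    by (intro sum.mono_neutral_cong_right) (auto simp: pmf_arw_jump[OF graph_G] arw_Z_eq_sum simp del: sum.insert)
  also have "\<dots> \<le> c - 1"
    using assms finite_neighbors[OF graph_G]
    by (intro normalized_weights_diff_le) (auto simp: arw_weight_def)
  finally show ?thesis .
qed

lemma exp_minus_one_le: "0 \<le> t \<Longrightarrow> t \<le> 1 \<Longrightarrow> exp t - 1 \<le> 2 * t" for t :: real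
  using exp_bound[of t] mult_left_le[of t t] by (simp add: power2_eq_square)

text \<open>An extra particle at \<open>i\<close> multiplies the weight of \<open>i\<close> by
  \<open>exp (\<beta> / n)\<close> and leaves the other weights unchanged.\<close>

lemma jump_add_particle_le:
  assumes "l \<in> verts G" "0 \<le> \<beta>" "\<beta> \<le> 1" "1 \<le> n"
  shows "(\<Sum>j\<in>verts G. \<bar>pmf (arw_jump G n \<beta> (add_particle z i) l) j - pmf (arw_jump G n \<beta> z l) j\<bar>)
    \<le> 2 * (\<beta> / n)"
proof -
  have \<beta>n: "0 \<le> \<beta> / n" "\<beta> / n \<le> 1" using assms by (auto simp: field_simps)
  have "(\<Sum>j\<in>verts G. \<bar>pmf (arw_jump G n \<beta> (add_particle z i) l) j - pmf (arw_jump G n \<beta> z l) j\<bar>)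
      \<le> exp (\<beta> / n) - 1"
  proof (rule jump_perturbation_le[OF assms(1)])
    fix j
    show "arw_weight n \<beta> z l j \<le> arw_weight n \<beta> (add_particle z i) l j"
      using \<beta>n by (auto simp: arw_weight_def add_particle_def intro!: divide_right_mono mult_left_mono assms(2))
    show "arw_weight n \<beta> (add_particle z i) l j \<le> exp (\<beta> / n) * arw_weight n \<beta> z l j"
      using \<beta>n by (auto simp: arw_weight_def add_particle_def algebra_simps add_divide_distrib
          diff_divide_distrib simp flip: exp_add)
  qed (use \<beta>n in auto)
  then show ?thesis using exp_minus_one_le[OF \<beta>n] by linarith
qed

lemma states_le: "z \<in> arw_states G m \<Longrightarrow> z i \<le> m"
  using member_le_sum[of i "verts G" z] by (cases "i \<in> verts G") (auto simp: arw_states_def)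

text \<open>The term -1 in the staying weight cancels the distinguished particle. All weights thus
  depend on \<open>z\<close> only and lie between 1 and \<open>exp \<beta>\<close>, whereas the free
  weights are all 1.\<close>

lemma jump_free_le:
  assumes "i \<in> verts G" "0 \<le> \<beta>" "\<beta> \<le> 1" "z \<in> arw_states G (n - 1)" "1 \<le> n"
  shows "(\<Sum>j\<in>verts G. \<bar>pmf (arw_jump G n \<beta> (add_particle z i) i) j - pmf (arw_jump G 1 0 (\<lambda>_. 0) i) j\<bar>)
    \<le> 2 * \<beta>"
proof -
  have "(\<Sum>j\<in>verts G. \<bar>pmf (arw_jump G n \<beta> (add_particle z i) i) j - pmf (arw_jump G 1 0 (\<lambda>_. 0) i) j\<bar>)
      \<le> exp \<beta> - 1"
  proof (rule jump_perturbation_le[OF assms(1)])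
    fix j
    have exponent: "0 \<le> \<beta> / n * real m" "\<beta> / n * real m \<le> \<beta>" if "m \<le> n" for m
      using that assms(2,5) by (auto simp: field_simps mult_left_mono)
    have m: "arw_weight n \<beta> (add_particle z i) i j = exp (\<beta> / n * real (z j))" for j
      by (simp add: arw_weight_def add_particle_def)
    have "z j \<le> n" using states_le[OF assms(4), of j] by simp
    then show "arw_weight 1 0 (\<lambda>_. 0) i j \<le> arw_weight n \<beta> (add_particle z i) i j"
      "arw_weight n \<beta> (add_particle z i) i j \<le> exp \<beta> * arw_weight 1 0 (\<lambda>_. 0) i j"
      using exponent[of "z j"] unfolding m by (cases "j = i"; simp add: arw_weight_def)+
  qed (use assms in auto)
  then show ?thesis using exp_minus_one_le[OF assms(2,3)] by linarith
qed

end

text \<open>The free walk is the motion of one particle at \<open>\<beta> = 0\<close>.\<close>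

locale arw_free_walk = arw +
  fixes T :: nat
  assumes T_pos: "1 \<le> T"
    and free_walk_contracts:
      "osc (verts G) ((finite_chain.step (verts G) (arw_jump G 1 0 (\<lambda>_. 0)) ^^ T) g) \<le> osc (verts G) g / 2"
begin

sublocale walk: ergodic_chain "verts G" "arw_jump G 1 0 (\<lambda>_. 0)"
  by (rule ergodic_chain_walk)

text \<open>Fixing \<open>n - 1\<close> particles and varying the last covers every pair of
  configurations that differ in the position of one particle.\<close>

definition particle_lipschitz :: "nat \<Rightarrow> (('a \<Rightarrow> nat) \<Rightarrow> real) \<Rightarrow> real \<Rightarrow> bool" where
  "particle_lipschitz n f L \<longleftrightarrow>
     (\<forall>z\<in>arw_states G (n - 1). walk.cum_osc T (\<lambda>i. f (add_particle z i)) \<le> L)"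

lemma add_particle_in_states':
  "z \<in> arw_states G (n - 1) \<Longrightarrow> i \<in> verts G \<Longrightarrow> 1 \<le> n \<Longrightarrow> add_particle z i \<in> arw_states G n"
  using add_particle_in_states[of z "n - 1" i] by simp

text \<open>The step is compared with a decoupled one (\<open>main\<close>), whose seminorm is at
  most (n - 1)/n * L + 1/n * (1 - 1/(2T)) * L. The pointwise error is at most 4 \<beta> L / n, which
  adds 8 T \<beta> L / n to the seminorm.\<close>

lemma particle_lipschitz_step:
  assumes f: "particle_lipschitz n f L" and \<beta>: "0 \<le> \<beta>" "\<beta> \<le> 1" and n: "1 \<le> n"
  shows "particle_lipschitz n (finite_chain.step (arw_states G n) (arw_kernel G n \<beta>) f)
    ((1 - (1 / (2 * real T) - 8 * real T * \<beta>) / n) * L)"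
  unfolding particle_lipschitz_def
proof
  fix z assume z: "z \<in> arw_states G (n - 1)"
  let ?V = "verts G"
  let ?q = "\<lambda>i j. pmf (arw_jump G 1 0 (\<lambda>_. 0) i) j"
  let ?p = "\<lambda>x i j. pmf (arw_jump G n \<beta> x i) j"
  let ?zl = "\<lambda>l. z(l := z l - 1)"
  let ?h = "\<lambda>i. finite_chain.step (arw_states G n) (arw_kernel G n \<beta>) f (add_particle z i)"
  \<comment> \<open>\<open>other l i\<close> moves a particle at \<open>l\<close> as if the
    distinguished particle at \<open>i\<close> were absent, and \<open>self\<close> moves the
    distinguished particle by the free walk. \<open>main\<close> combines them with the selection
    probabilities.\<close>
  define other where
    "other l i = (\<Sum>m\<in>?V. ?p z l m * f (add_particle (add_particle (?zl l) m) i))" for l i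
  define self where "self = walk.step (\<lambda>i. f (add_particle z i))"
  define main where "main i = (\<Sum>l\<in>?V. z l / n * other l i) + 1 / n * self i" for i
  have L: "walk.cum_osc T (\<lambda>i. f (add_particle z' i)) \<le> L" if "z' \<in> arw_states G (n - 1)" for z'
    using f that by (simp add: particle_lipschitz_def)
  have osc_L: "osc ?V (\<lambda>i. f (add_particle z' i)) \<le> L" if "z' \<in> arw_states G (n - 1)" for z'
    using L[OF that] walk.osc_le_cum_osc[OF T_pos] order_trans by blast
  have L0: "0 \<le> L" using L[OF z] walk.cum_osc_nonneg order_trans by blast
  have zl: "?zl l \<in> arw_states G (n - 2)" "2 \<le> n" if "1 \<le> z l" for l
  proof -
    show "2 \<le> n" using states_le[OF z, of l] that by simp
    then have "n - 1 = Suc (n - 2)" by simp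
    then show "?zl l \<in> arw_states G (n - 2)" using states_decompose(2)[of z "n - 2" l] z that by simp
  qed
  have zlm: "add_particle (?zl l) m \<in> arw_states G (n - 1)" if "1 \<le> z l" "m \<in> ?V" for l m
  proof -
    have "Suc (n - 2) = n - 1" using zl(2)[OF that(1)] by linarith
    then show ?thesis using add_particle_in_states[OF zl(1)[OF that(1)] that(2)] by metis
  qed
  have sum_z: "(\<Sum>l\<in>?V. z l / n) = (n - 1) / n"
    using z n by (simp add: arw_states_def flip: sum_divide_distrib of_nat_sum)

  have main_le: "walk.cum_osc T main \<le> (1 - 1 / (2 * real T * real n)) * L"
  proof -
    have o: "walk.cum_osc T (other l) \<le> L" if l: "l \<in> ?V" "1 \<le> z l" for l
    proof -
      have "walk.cum_osc T (other l)
          \<le> (\<Sum>m\<in>?V. ?p z l m * walk.cum_osc T (\<lambda>i. f (add_particle (add_particle (?zl l) m) i)))"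
        unfolding other_def by (intro walk.cum_osc_sum_le) auto
      also have "\<dots> \<le> (\<Sum>m\<in>?V. ?p z l m * L)"
        using L zlm l by (intro sum_mono mult_left_mono) auto
      also have "\<dots> = L" using sum_pmf_arw_jump[OF l(1)] by (simp flip: sum_distrib_right)
      finally show ?thesis .
    qed
    have "walk.cum_osc T main
        \<le> (\<Sum>l\<in>?V. z l / n * walk.cum_osc T (other l)) + 1 / n * walk.cum_osc T self"
      unfolding main_def
      by (intro order_trans[OF walk.cum_osc_add_le] add_mono walk.cum_osc_sum_le walk.cum_osc_cmult_le) auto
    also have "\<dots> \<le> (\<Sum>l\<in>?V. z l / n * L) + 1 / n * ((1 - 1 / (2 * real T)) * L)"
    proof (rule add_mono[OF sum_mono mult_left_mono])
      show "z l / n * walk.cum_osc T (other l) \<le> z l / n * L" if "l \<in> ?V" for l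
        using o[OF that] by (cases "z l = 0") (auto intro!: mult_left_mono divide_right_mono)
      have "walk.cum_osc T self \<le> (1 - 1 / (2 * real T)) * walk.cum_osc T (\<lambda>i. f (add_particle z i))"
        unfolding self_def by (rule walk.cum_osc_step[OF T_pos free_walk_contracts])
      also have "\<dots> \<le> (1 - 1 / (2 * real T)) * L"
        using L[OF z] T_pos by (intro mult_left_mono) auto
      finally show "walk.cum_osc T self \<le> (1 - 1 / (2 * real T)) * L" .
    qed auto
    also have "\<dots> = (1 - 1 / (2 * real T * real n)) * L"
      using n T_pos unfolding sum_distrib_right[symmetric] sum_z by (simp add: field_simps of_nat_diff)
    finally show ?thesis .
  qed

  have err_le: "\<bar>?h i - main i\<bar> \<le> 4 * \<beta> * L / n" if i: "i \<in> ?V" for i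
  proof -
    let ?x = "add_particle z i"
    define A where "A l = (\<Sum>m\<in>?V. ?p ?x l m * f (move_particle ?x l m))" for l
    have x: "?x \<in> arw_states G n" by (rule add_particle_in_states'[OF z i n])
    have A_i: "A i = (\<Sum>m\<in>?V. ?p ?x i m * f (add_particle z m))"
      unfolding A_def by (intro sum.cong) (auto simp: move_particle_def add_particle_def Let_def)
    have x_eq: "?x l = z l + (if l = i then 1 else 0)" for l by (simp add: add_particle_def)
    have "?h i = (\<Sum>l\<in>?V. ?x l / n * A l)" unfolding A_def by (rule step_arw[OF x n])
    \<comment> \<open>The selected particle is either one of those in \<open>z\<close> or, with
      probability 1/n, the distinguished one at \<open>i\<close>.\<close>
    also have "\<dots> = (\<Sum>l\<in>?V. z l / n * A l + (if l = i then 1 / n * A i else 0))"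
      by (intro sum.cong) (auto simp: x_eq add_divide_distrib distrib_right)
    also have "\<dots> = (\<Sum>l\<in>?V. z l / n * A l) + 1 / n * A i" using i by (simp add: sum.distrib)
    finally have "?h i - main i = (\<Sum>l\<in>?V. z l / n * (A l - other l i)) + 1 / n * (A i - self i)"
      by (simp add: main_def right_diff_distrib sum_subtractf)
    moreover have "\<bar>\<Sum>l\<in>?V. z l / n * (A l - other l i)\<bar> \<le> (\<Sum>l\<in>?V. z l / n * (2 * (\<beta> / n) * L))"
    proof (intro order_trans[OF sum_abs] sum_mono)
      fix l assume l: "l \<in> ?V"
      show "\<bar>z l / n * (A l - other l i)\<bar> \<le> z l / n * (2 * (\<beta> / n) * L)"
      \<comment> \<open>Removing a particle from \<open>l\<close> is meaningful only if one is
        there; otherwise the factor \<open>z l / n\<close> vanishes.\<close>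
      proof (cases "z l = 0")
        case False
        let ?g = "\<lambda>m. f (add_particle (add_particle (?zl l) i) m)"
        have A_l: "A l = (\<Sum>m\<in>?V. ?p ?x l m * ?g m)"
          unfolding A_def
        proof (intro sum.cong refl)
          fix m
          have "move_particle ?x l m = add_particle (add_particle (?zl l) i) m"
            using False by (auto simp: move_particle_def add_particle_def Let_def)
          then show "?p ?x l m * f (move_particle ?x l m) = ?p ?x l m * ?g m" by simp
        qed
        have other_l: "other l i = (\<Sum>m\<in>?V. ?p z l m * ?g m)"
          unfolding other_def
        proof (intro sum.cong refl)
          fix m
          have "add_particle (add_particle (?zl l) m) i = add_particle (add_particle (?zl l) i) m"
            by (auto simp: add_particle_def)
          then show "?p z l m * f (add_particle (add_particle (?zl l) m) i) = ?p z l m * ?g m" by simp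
        qed
        have "\<bar>A l - other l i\<bar> \<le> (\<Sum>m\<in>?V. \<bar>?p ?x l m - ?p z l m\<bar>) * osc ?V ?g"
          unfolding A_l other_l
          by (rule walk.averaged_difference_le) (simp add: sum_pmf_arw_jump[OF l])
        also have "\<dots> \<le> 2 * (\<beta> / n) * L"
          using jump_add_particle_le[OF l \<beta> n] osc_L[OF zlm[of l i]] False i \<beta>
            osc_nonneg[OF walk.finite_states walk.states_nonempty]
          by (intro mult_mono) auto
        finally have "z l / n * \<bar>A l - other l i\<bar> \<le> z l / n * (2 * (\<beta> / n) * L)"
          by (intro mult_left_mono) auto
        then show ?thesis by (simp add: abs_mult)
      qed simp
    qed
    moreover have "(\<Sum>l\<in>?V. z l / n * (2 * (\<beta> / n) * L)) \<le> 1 / n * (2 * \<beta> * L)"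
    proof -
      have "(\<Sum>l\<in>?V. z l / n * (2 * (\<beta> / n) * L)) = (n - 1) / n * (2 * (\<beta> / n) * L)"
        unfolding sum_distrib_right[symmetric] sum_z ..
      also have "\<dots> \<le> 1 * (2 * (\<beta> / n) * L)"
        using n \<beta> L0 by (intro mult_right_mono) auto
      finally show ?thesis by simp
    qed
    moreover have "\<bar>1 / n * (A i - self i)\<bar> \<le> 1 / n * (2 * \<beta> * L)"
    proof -
      have "\<bar>A i - self i\<bar> \<le> (\<Sum>m\<in>?V. \<bar>?p ?x i m - ?q i m\<bar>) * osc ?V (\<lambda>m. f (add_particle z m))"
        unfolding A_i self_def walk.step_def
        by (rule walk.averaged_difference_le) (simp add: sum_pmf_arw_jump[OF i])
      also have "\<dots> \<le> 2 * \<beta> * L"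
        using jump_free_le[OF i \<beta> z n] osc_L[OF z] \<beta>
          osc_nonneg[OF walk.finite_states walk.states_nonempty]
        by (intro mult_mono) auto
      finally show ?thesis by (simp add: abs_mult divide_right_mono)
    qed
    ultimately have "\<bar>?h i - main i\<bar> \<le> 1 / n * (2 * \<beta> * L) + 1 / n * (2 * \<beta> * L)"
      by (simp only: order_trans[OF abs_triangle_ineq add_mono[OF order_trans]])
    then show ?thesis by (simp add: mult_ac)
  qed

  have "walk.cum_osc T ?h \<le> walk.cum_osc T main + walk.cum_osc T (\<lambda>i. ?h i - main i)"
    using walk.cum_osc_add_le[of T main "\<lambda>i. ?h i - main i"] by simp
  \<comment> \<open>The oscillation is at most twice the uniform bound on the error, and it is
    counted at \<open>T\<close> times.\<close>
  moreover have "walk.cum_osc T (\<lambda>i. ?h i - main i) \<le> real T * (2 * (4 * \<beta> * L / n))"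
    using err_le
    by (intro order_trans[OF walk.cum_osc_le] mult_left_mono
        osc_le_bound[OF walk.finite_states walk.states_nonempty]) auto
  moreover have "(1 - (1 / (2 * real T) - 8 * real T * \<beta>) / n) * L
      = (1 - 1 / (2 * real T * real n)) * L + real T * (2 * (4 * \<beta> * L / n))"
    using n T_pos by (simp add: field_simps)
  ultimately show "walk.cum_osc T ?h \<le> (1 - (1 / (2 * real T) - 8 * real T * \<beta>) / n) * L"
    using main_le by linarith
qed

lemma particle_lipschitz_steps:
  assumes "particle_lipschitz n f L" "0 \<le> \<beta>" "\<beta> \<le> 1" "1 \<le> n"
  shows "particle_lipschitz n ((finite_chain.step (arw_states G n) (arw_kernel G n \<beta>) ^^ t) f)
    ((1 - (1 / (2 * real T) - 8 * real T * \<beta>) / n) ^ t * L)"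
proof (induction t)
  case (Suc t)
  show ?case using particle_lipschitz_step[OF Suc assms(2-4)] by (simp add: mult.assoc)
qed (use assms in simp)

lemma particle_lipschitz_indicator:
  assumes "1 \<le> n"
  shows "particle_lipschitz n (indicator A) T"
  unfolding particle_lipschitz_def
proof
  fix z
  have "walk.cum_osc T (\<lambda>i. indicator A (add_particle z i)) \<le> real T * osc (verts G) (\<lambda>i. indicator A (add_particle z i))"
    by (rule walk.cum_osc_le)
  also have "\<dots> \<le> real T * 1"
    by (intro mult_left_mono osc_le walk.finite_states walk.states_nonempty) (auto split: split_indicator)
  finally show "walk.cum_osc T (\<lambda>i. indicator A (add_particle z i)) \<le> T" by simp
qed

section \<open>From the Lipschitz seminorm to the mixing time\<close>

lemma particle_lipschitz_diff_le:
  assumes f: "particle_lipschitz n f L"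
  shows "m \<le> n \<Longrightarrow> w \<in> arw_states G (n - m) \<Longrightarrow> x \<in> arw_states G m \<Longrightarrow> y \<in> arw_states G m \<Longrightarrow>
    f (\<lambda>v. w v + x v) - f (\<lambda>v. w v + y v) \<le> m * L"
proof (induction m arbitrary: w x y)
  case 0
  then have "x = (\<lambda>_. 0)" "y = (\<lambda>_. 0)" by (auto simp: arw_states_def fun_eq_iff)
  then show ?case by simp
next
  \<comment> \<open>A particle of \<open>x\<close> at \<open>i\<close> joins the common part
    \<open>w\<close>. The induction hypothesis turns the rest of \<open>x\<close> into the rest of
    \<open>y\<close>, and a last move from \<open>i\<close> to \<open>j\<close> costs at most
    \<open>L\<close>.\<close>
  case (Suc m)
  obtain i j where ij: "i \<in> verts G" "1 \<le> x i" "j \<in> verts G" "1 \<le> y j"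
    using states_pos[OF Suc.prems(3)] states_pos[OF Suc.prems(4)] by (metis le_add1 plus_1_eq_Suc)
  let ?x = "x(i := x i - 1)" and ?y = "y(j := y j - 1)"
  note x = states_decompose[OF Suc.prems(3) ij(2)] and y = states_decompose[OF Suc.prems(4) ij(4)]
  let ?w = "\<lambda>v. w v + ?y v"
  have w: "add_particle w i \<in> arw_states G (n - m)"
    using add_particle_in_states[OF Suc.prems(2) ij(1)] Suc.prems(1) by (simp add: Suc_diff_Suc)
  have wy: "?w \<in> arw_states G (n - 1)"
    using Suc.prems(1,2) y(2) by (auto simp: arw_states_def sum.distrib simp del: fun_upd_apply)
  have "f (\<lambda>v. w v + x v) = f (\<lambda>v. add_particle w i v + ?x v)"
    using ij by (intro arg_cong[where f = f]) (auto simp: add_particle_def)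
  moreover have "f (\<lambda>v. add_particle w i v + ?x v) - f (\<lambda>v. add_particle w i v + ?y v) \<le> m * L"
    by (intro Suc.IH[OF _ w x(2) y(2)]) (use Suc.prems(1) in simp)
  moreover have "f (\<lambda>v. add_particle w i v + ?y v) = f (add_particle ?w i)"
    by (intro arg_cong[where f = f]) (auto simp: add_particle_def)
  moreover have "f (\<lambda>v. w v + y v) = f (add_particle ?w j)"
    using ij by (intro arg_cong[where f = f]) (auto simp: add_particle_def)
  moreover have "f (add_particle ?w i) - f (add_particle ?w j) \<le> L"
    using osc_ge[OF walk.finite_states ij(1,3), of "\<lambda>i. f (add_particle ?w i)"]
      walk.osc_le_cum_osc[OF T_pos, of "\<lambda>i. f (add_particle ?w i)"] f wy
    by (fastforce simp: particle_lipschitz_def simp del: fun_upd_apply)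
  ultimately show ?case by (simp add: algebra_simps del: fun_upd_apply)
qed

lemma osc_particle_lipschitz_le:
  assumes "particle_lipschitz n f L" "1 \<le> n"
  shows "osc (arw_states G n) f \<le> n * L"
proof -
  interpret chain: finite_chain "arw_states G n" "arw_kernel G n 0" by (rule finite_chain_arw[OF assms(2)])
  have "(\<lambda>_. 0) \<in> arw_states G (n - n)" by (simp add: arw_states_def)
  then show ?thesis
    using particle_lipschitz_diff_le[OF assms(1), of n "\<lambda>_. 0"]
    by (intro osc_le chain.finite_states chain.states_nonempty) auto
qed

text \<open>An indicator has Lipschitz bound \<open>T\<close>, so after \<open>t\<close> steps its
  oscillation is at most n * T * exp(-c t / n), which is 1/4 at t = (n / c) ln (4 T n). The
  threshold on \<beta> is the condition c > 0.\<close>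

lemma arw_mixing_time_le:
  assumes \<beta>: "0 \<le> \<beta>" "\<beta> < 1 / (16 * (real T)\<^sup>2)" and n: "1 \<le> n"
  defines "c \<equiv> 1 / (2 * real T) - 8 * real T * \<beta>"
  shows "arw_mixing_time G n \<beta> \<le> n / c * ln (4 * real T * real n) + 1"
proof -
  interpret chain: ergodic_chain "arw_states G n" "arw_kernel G n \<beta>" by (rule ergodic_chain_arw[OF n])
  have T: "1 \<le> real T" using T_pos by simp
  have "8 * real T * \<beta> < 8 * real T * (1 / (16 * (real T)\<^sup>2))" using \<beta> T by (intro mult_strict_left_mono) auto
  also have "\<dots> = 1 / (2 * real T)" using T by (simp add: power2_eq_square)
  finally have c: "0 < c" by (simp add: c_def)
  have "1 / (2 * real T) \<le> 1" "0 \<le> 8 * real T * \<beta>" using T \<beta> by simp_all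
  then have "c \<le> 1" unfolding c_def by linarith
  then have cn: "0 \<le> 1 - c / n" using n by (simp add: field_simps)
  have "1 / (16 * (real T)\<^sup>2) \<le> 1" using T by (simp add: power2_eq_square field_simps mult_ge1_I)
  then have \<beta>1: "\<beta> \<le> 1" using \<beta> by linarith
  have ln0: "0 \<le> ln (4 * real T * real n)" using T n mult_ge1_I[of "real T" "real n"] by (intro ln_ge_zero) simp
  define t where "t = nat \<lceil>n / c * ln (4 * real T * real n)\<rceil>"
  have t: "n / c * ln (4 * real T * real n) \<le> t" unfolding t_def by (simp add: real_nat_ceiling_ge)
  have "osc (arw_states G n) ((chain.step ^^ t) (indicator A)) \<le> 1 / 4" for A
  proof -
    have "osc (arw_states G n) ((chain.step ^^ t) (indicator A)) \<le> n * ((1 - c / n) ^ t * T)"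
      using osc_particle_lipschitz_le[OF particle_lipschitz_steps[OF particle_lipschitz_indicator[OF n] \<beta>(1) \<beta>1 n] n]
      by (simp add: c_def)
    also have "(1 - c / n) ^ t \<le> exp (- (c / n)) ^ t"
      using cn exp_ge_add_one_self[of "- (c / n)"] by (intro power_mono) auto
    also have "exp (- (c / n)) ^ t = exp (- (c / n * t))" by (simp flip: exp_of_nat2_mult)
    also have "\<dots> \<le> exp (- ln (4 * real T * real n))"
      using mult_left_mono[OF t, of "c / n"] c n by simp
    also have "\<dots> = 1 / (4 * real T * real n)" using T n by (simp add: exp_minus inverse_eq_divide)
    also have "n * (1 / (4 * real T * real n) * T) = (1 / 4 :: real)" using T n by (simp add: field_simps)
    finally show ?thesis using T n by (simp add: mult_left_mono mult_right_mono)
  qed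
  then have "arw_mixing_time G n \<beta> \<le> t" unfolding arw_mixing_time_def by (rule chain.mixing_time_le)
  moreover have "0 \<le> n / c * ln (4 * real T * real n)" using c ln0 by simp
  then have "t \<le> n / c * ln (4 * real T * real n) + 1"
    unfolding t_def using ceiling_correct[of "n / c * ln (4 * real T * real n)"] by simp
  ultimately show ?thesis by linarith
qed

end

context arw
begin

section \<open>Slow mixing at low temperature\<close>

definition vdist :: "'a \<Rightarrow> 'a \<Rightarrow> nat" where
  "vdist v i = (LEAST m. (v, i) \<in> arcs_ends G ^^ m)"

lemma vdist_le: "(v, i) \<in> arcs_ends G ^^ m \<Longrightarrow> vdist v i \<le> m"
  unfolding vdist_def by (rule Least_le)

lemma vdist_relpow: "v \<in> verts G \<Longrightarrow> i \<in> verts G \<Longrightarrow> (v, i) \<in> arcs_ends G ^^ vdist v i"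
  unfolding vdist_def
  using rtrancl_imp_relpow[OF reachable_rtranclI[OF reach]] by (rule LeastI_ex)

lemma vdist_self [simp]: "vdist v v = 0"
  using vdist_le[of v v 0] by simp

lemma vdist_neighbor_le:
  assumes "v \<in> verts G" "j \<in> neighbors G i"
  shows "vdist v j \<le> Suc (vdist v i)"
  using vdist_relpow[OF assms(1), of i] neighbor_in_verts[OF assms(2)] assms(2)
  by (intro vdist_le) (auto simp: neighbors_def)

lemma vdist_eq_0_iff: "v \<in> verts G \<Longrightarrow> i \<in> verts G \<Longrightarrow> vdist v i = 0 \<longleftrightarrow> i = v"
  using vdist_relpow[of v i] by auto

text \<open>The vertex before \<open>i\<close> on a shortest walk from \<open>v\<close> is one step
  closer.\<close>

lemma closer_neighbor:
  assumes v: "v \<in> verts G" and i: "i \<in> verts G" "i \<noteq> v"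
  obtains j where "j \<in> neighbors G i" "vdist v i = Suc (vdist v j)"
proof -
  obtain m where m: "vdist v i = Suc m"
    using vdist_eq_0_iff[OF v i(1)] i(2) not0_implies_Suc by blast
  then obtain j where j: "(v, j) \<in> arcs_ends G ^^ m" "(j, i) \<in> arcs_ends G"
    using vdist_relpow[OF v i(1)] by auto
  have "i \<in> neighbors G j" using j(2) by (simp add: neighbors_def)
  moreover from this have "Suc m \<le> Suc (vdist v j)" using vdist_neighbor_le[OF v] m by metis
  ultimately show ?thesis using that neighbor_sym vdist_le[OF j(1)] m by (metis Suc_le_mono le_antisym)
qed

definition diam :: nat where
  "diam = Max ((\<lambda>(v, i). vdist v i) ` (verts G \<times> verts G))"

lemma vdist_le_diam: "v \<in> verts G \<Longrightarrow> i \<in> verts G \<Longrightarrow> vdist v i \<le> diam"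
  unfolding diam_def by (intro Max_ge) force+

text \<open>Half of 1/(3k) for k vertices: a jump whose weight is within a factor 3 of the largest
  has probability at least 1/(3k), see \<open>jump_probability_ge\<close>.\<close>

definition ratio :: real where
  "ratio = 1 / (6 * card (verts G))"

lemma ratio_bounds: "0 < ratio" "ratio \<le> 1 / 2"
  using card_verts by (auto simp: ratio_def field_simps)

text \<open>
  Increments decrease geometrically, so that a step towards \<open>v\<close> taken with probability at least
  \<open>2 * ratio\<close> outweighs any step away from \<open>v\<close>.
\<close>

definition potential :: "nat \<Rightarrow> real" where
  "potential m = (\<Sum>s<m. ratio ^ s)"

lemma potential_0 [simp]: "potential 0 = 0"
  and potential_Suc: "potential (Suc m) = potential m + ratio ^ m"
  by (simp_all add: potential_def)

lemma potential_mono: "m \<le> m' \<Longrightarrow> potential m \<le> potential m'"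
  unfolding potential_def using ratio_bounds by (intro sum_mono2) auto

lemma potential_bounds:
  shows "0 \<le> potential m" "potential m \<le> 2" "1 \<le> m \<Longrightarrow> 1 \<le> potential m"
proof -
  show "0 \<le> potential m" using ratio_bounds by (simp add: potential_def sum_nonneg)
  \<comment> \<open>Carrying the tail bound of the geometric series makes the claim inductive; it
    uses ratio \<le> 1/2.\<close>
  have "potential m + 2 * ratio ^ m \<le> 2"
  proof (induction m)
    case (Suc m)
    have "2 * ratio * ratio ^ m \<le> 1 * ratio ^ m" using ratio_bounds by (intro mult_right_mono) auto
    then show ?case using Suc by (simp add: potential_Suc)
  qed simp
  then show "potential m \<le> 2" using ratio_bounds by (smt (verit) zero_le_power)
  show "1 \<le> potential m" if "1 \<le> m"
    using potential_mono[OF that] by (simp add: potential_def)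
qed

definition spread :: "'a \<Rightarrow> ('a \<Rightarrow> nat) \<Rightarrow> real" where
  "spread v x = (\<Sum>i\<in>verts G. potential (vdist v i) * x i)"

text \<open>The potential is 0 at \<open>v\<close> and between 1 and 2 elsewhere, so the spread is
  comparable to the number of particles away from \<open>v\<close>.\<close>

lemma spread_bounds:
  assumes "x \<in> arw_states G n" "v \<in> verts G"
  shows "real n - x v \<le> spread v x" "spread v x \<le> 2 * (real n - x v)"
proof -
  have n: "real n - x v = (\<Sum>i\<in>verts G - {v}. real (x i))"
    using assms by (simp add: arw_states_def sum.remove[of _ v] flip: of_nat_sum)
  have s: "spread v x = (\<Sum>i\<in>verts G - {v}. potential (vdist v i) * x i)"
    using assms(2) by (simp add: spread_def sum.remove[of _ v])
  have "1 \<le> potential (vdist v i)" if "i \<in> verts G - {v}" for i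
    using that vdist_eq_0_iff[OF assms(2), of i] by (intro potential_bounds) auto
  then show "real n - x v \<le> spread v x" unfolding n s
    by (intro sum_mono) (metis mult_1 mult_right_mono of_nat_0_le_iff)
  show "spread v x \<le> 2 * (real n - x v)" unfolding n s sum_distrib_left
    using potential_bounds by (intro sum_mono mult_right_mono) auto
qed

lemma spread_move:
  assumes "1 \<le> x i" "i \<in> verts G" "j \<in> verts G"
  shows "spread v (move_particle x i j) - spread v x = potential (vdist v j) - potential (vdist v i)"
proof -
  let ?w = "\<lambda>i. potential (vdist v i)"
  have eq: "real (move_particle x i j l) = real (x l) - (if l = i then 1 else 0) + (if l = j then 1 else 0)" for l
    using assms(1) by (auto simp: move_particle_def Let_def of_nat_diff)
  have "spread v (move_particle x i j)
      = (\<Sum>l\<in>verts G. ?w l * real (x l) - (if l = i then ?w l else 0) + (if l = j then ?w l else 0))"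
    unfolding spread_def eq
    by (intro sum.cong refl) (simp add: right_diff_distrib distrib_left if_distrib cong: if_cong)
  also have "\<dots> = spread v x - ?w i + ?w j"
    using assms by (simp add: spread_def sum.distrib sum_subtractf)
  finally show ?thesis by simp
qed

lemma jump_probability_ge:
  assumes "i \<in> verts G" "j \<in> insert i (neighbors G i)"
    and "\<And>l. l \<in> insert i (neighbors G i) \<Longrightarrow> arw_weight n \<beta> x i l \<le> 3 * arw_weight n \<beta> x i j"
  shows "2 * ratio \<le> pmf (arw_jump G n \<beta> x i) j"
proof -
  let ?A = "insert i (neighbors G i)" and ?w = "arw_weight n \<beta> x i j"
  have w: "0 < ?w" by (simp add: arw_weight_def)
  have "?A \<subseteq> verts G" using assms(1) neighbor_in_verts by auto
  then have cA: "card ?A \<le> card (verts G)" by (intro card_mono) auto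
  have "arw_Z G n \<beta> x i \<le> (\<Sum>l\<in>?A. 3 * ?w)" unfolding arw_Z_eq_sum using assms(3) by (rule sum_mono)
  also have "\<dots> = card ?A * (3 * ?w)" by simp
  also have "\<dots> \<le> card (verts G) * (3 * ?w)" using cA w by (intro mult_right_mono) auto
  finally have "?w / (card (verts G) * (3 * ?w)) \<le> ?w / arw_Z G n \<beta> x i"
    using w arw_Z_pos[OF graph_G, of n \<beta> x i] by (intro divide_left_mono) auto
  moreover have "2 * ratio = ?w / (card (verts G) * (3 * ?w))"
    using w by (simp add: ratio_def)
  ultimately show ?thesis using assms(2) by (simp add: pmf_arw_jump[OF graph_G])
qed

section \<open>Drift of the spread inside the trap around a vertex\<close>

context
  fixes n :: nat and \<beta> :: real and v :: 'a and x :: "'a \<Rightarrow> nat"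
  assumes n: "2 \<le> n" and \<beta>: "2 \<le> \<beta>" and v: "v \<in> verts G"
    and x: "x \<in> arw_states G n" and near: "spread v x < n / \<beta>"
begin

lemma near_concentrated: "real n - x v < n / \<beta>" "l \<noteq> v \<Longrightarrow> x l < n / \<beta>" "n / \<beta> \<le> n / 2"
proof -
  show near': "real n - x v < n / \<beta>" using spread_bounds(1)[OF x v] near by linarith
  show "n / \<beta> \<le> n / 2" using n \<beta> by (intro divide_left_mono) auto
  assume "l \<noteq> v"
  have "x l + x v \<le> n"
  proof (cases "l \<in> verts G")
    case True
    have "(\<Sum>i\<in>{l, v}. x i) \<le> (\<Sum>i\<in>verts G. x i)" using True v by (intro sum_mono2) auto
    then show ?thesis using x \<open>l \<noteq> v\<close> by (simp add: arw_states_def)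
  next
    case False
    then show ?thesis using x states_le[OF x, of v] by (simp add: arw_states_def)
  qed
  then show "x l < n / \<beta>" using near' by linarith
qed

text \<open>The radius n/\<beta> of the trap keeps the exponent below 1 away from \<open>v\<close>,
  and e \<le> 3.\<close>

lemma weight_off_peak: "l \<noteq> v \<Longrightarrow> arw_weight n \<beta> x i l \<le> 3"
proof -
  assume l: "l \<noteq> v"
  have "arw_weight n \<beta> x i l \<le> exp (\<beta> / n * x l)"
    using n \<beta> by (auto simp: arw_weight_def intro!: divide_right_mono mult_left_mono)
  also have "\<dots> \<le> exp 1" using near_concentrated(2)[OF l] n \<beta> by (simp add: field_simps)
  also have "\<dots> \<le> (3::real)" by (rule exp_le)
  finally show ?thesis .
qed

text \<open>With \<open>m\<close> the distance of a closer neighbor \<open>j0\<close>, the jump to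
  \<open>j0\<close> gains ratio^m with probability at least 2 * ratio, while any jump loses at most
  ratio^(m + 1). The net drift is at most -ratio^(m + 1).\<close>

lemma drift_off_peak:
  assumes i: "i \<in> verts G" "i \<noteq> v"
  shows "(\<Sum>j\<in>verts G. pmf (arw_jump G n \<beta> x i) j * (potential (vdist v j) - potential (vdist v i)))
    \<le> - (ratio ^ diam)"
proof -
  let ?p = "pmf (arw_jump G n \<beta> x i)" and ?w = "\<lambda>j. potential (vdist v j)"
  obtain j0 where j0: "j0 \<in> neighbors G i" "vdist v i = Suc (vdist v j0)"
    using closer_neighbor[OF v i] .
  let ?m = "vdist v j0"
  have j0V: "j0 \<in> verts G" "j0 \<noteq> i" using j0 neighbor_in_verts by auto
  have "2 * ratio \<le> ?p j0"
  proof (rule jump_probability_ge[OF i(1)])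
    fix l assume l: "l \<in> insert i (neighbors G i)"
    show "arw_weight n \<beta> x i l \<le> 3 * arw_weight n \<beta> x i j0"
    proof (cases "l = v")
      \<comment> \<open>The peak \<open>v\<close> is the only vertex whose weight may be large. If
        it is adjacent to \<open>i\<close>, the closer neighbor is \<open>v\<close> itself.\<close>
      case True
      then have "vdist v i \<le> 1"
        using l i neighbor_sym vdist_neighbor_le[OF v, of i v] by auto
      then have "j0 = v" using j0 j0V vdist_eq_0_iff[OF v] by simp
      then show ?thesis using True by (simp add: arw_weight_def)
    next
      case False
      have "1 \<le> arw_weight n \<beta> x i j0" using j0V(2) n \<beta> by (simp add: arw_weight_def)
      then show ?thesis using weight_off_peak[OF False, of i] by linarith
    qed
  qed (use j0 in simp)
  have "(\<Sum>j\<in>verts G. ?p j * (?w j - ?w i))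
      \<le> (\<Sum>j\<in>verts G. ?p j * ratio ^ Suc ?m - (if j = j0 then ?p j * ratio ^ ?m else 0))"
  proof (intro sum_mono)
    fix j assume j: "j \<in> verts G"
    show "?p j * (?w j - ?w i) \<le> ?p j * ratio ^ Suc ?m - (if j = j0 then ?p j * ratio ^ ?m else 0)"
    proof (cases "j = j0")
      case True
      then show ?thesis using j0(2) ratio_bounds by (simp add: potential_Suc algebra_simps)
    next
      case False
      show ?thesis
      proof (cases "j \<in> insert i (neighbors G i)")
        case True
        then have "vdist v j \<le> Suc (vdist v i)" using vdist_neighbor_le[OF v] by auto
        then have "?w j \<le> ?w i + ratio ^ Suc ?m"
          using potential_mono[of "vdist v j" "Suc (vdist v i)"] j0(2) by (simp add: potential_Suc)
        then have "?p j * (?w j - ?w i) \<le> ?p j * ratio ^ Suc ?m"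
          by (intro mult_left_mono) auto
        then show ?thesis using False by simp
      qed (use False in \<open>simp add: pmf_arw_jump[OF graph_G]\<close>)
    qed
  qed
  also have "\<dots> = ratio ^ Suc ?m - ?p j0 * ratio ^ ?m"
    using sum_pmf_arw_jump[OF i(1)] j0V(1) by (simp add: sum_subtractf flip: sum_distrib_right)
  also have "\<dots> \<le> ratio ^ Suc ?m - 2 * ratio * ratio ^ ?m"
    using \<open>2 * ratio \<le> ?p j0\<close> ratio_bounds by (intro diff_left_mono mult_right_mono) auto
  also have "\<dots> = - (ratio ^ vdist v i)" using j0(2) by simp
  also have "\<dots> \<le> - (ratio ^ diam)"
    using vdist_le_diam[OF v i(1)] ratio_bounds by (simp add: power_decreasing)
  finally show ?thesis .
qed

text \<open>Staying at \<open>v\<close> has weight at least \<open>exp (\<beta> / 2 - 2)\<close>,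
  each neighbor has weight at most 3 and potential at most 2.\<close>

lemma drift_at_peak:
  "(\<Sum>j\<in>verts G. pmf (arw_jump G n \<beta> x v) j * (potential (vdist v j) - potential (vdist v v)))
    \<le> card (verts G) * (6 * exp (2 - \<beta> / 2))"
proof (rule sum_bounded_above)
  fix j assume j: "j \<in> verts G"
  let ?p = "pmf (arw_jump G n \<beta> x v)"
  show "?p j * (potential (vdist v j) - potential (vdist v v)) \<le> 6 * exp (2 - \<beta> / 2)"
  proof (cases "j \<in> neighbors G v")
    case True
    then have jv: "j \<noteq> v" using not_self_neighbor[OF graph_G] by auto
    \<comment> \<open>More than n - n/\<beta> particles are at \<open>v\<close>, so the exponent
      exceeds \<beta> - 1 - \<beta>/n, and n \<ge> 2.\<close>
    have "\<beta> / 2 - 2 \<le> \<beta> / n * (real (x v) - 1)"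
    proof -
      have "\<beta> * n - n < \<beta> * x v" using near_concentrated(1) \<beta> by (simp add: field_simps)
      moreover have "\<beta> * 2 \<le> \<beta> * n" using n \<beta> by (intro mult_left_mono) auto
      moreover have "0 < real n" using n by simp
      ultimately show ?thesis by (simp add: field_simps)
    qed
    then have "exp (\<beta> / 2 - 2) \<le> arw_weight n \<beta> x v v" by (simp add: arw_weight_def)
    also have "\<dots> \<le> arw_Z G n \<beta> x v"
      unfolding arw_Z_def by (simp add: sum_nonneg arw_weight_def)
    finally have Z: "exp (\<beta> / 2 - 2) \<le> arw_Z G n \<beta> x v" .
    have "?p j = arw_weight n \<beta> x v j / arw_Z G n \<beta> x v"
      using True by (simp add: pmf_arw_jump[OF graph_G])
    also have "\<dots> \<le> 3 / exp (\<beta> / 2 - 2)"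
      using Z weight_off_peak[OF jv] by (intro frac_le) auto
    also have "\<dots> = 3 * exp (2 - \<beta> / 2)" by (simp add: exp_diff)
    finally have "?p j * potential (vdist v j) \<le> 3 * exp (2 - \<beta> / 2) * 2"
      using potential_bounds by (intro mult_mono) auto
    then show ?thesis by simp
  next
    case False
    then show ?thesis by (cases "j = v") (auto simp: pmf_arw_jump[OF graph_G])
  qed
qed

text \<open>At least n/(4 \<beta>) particles are away from \<open>v\<close>, and they give drift at
  most -ratio^diam / (4 \<beta>). By \<open>cold\<close>, where 96 = 6 * 16, the outward drift at
  \<open>v\<close> is at most a quarter of that amount.\<close>

lemma spread_drift:
  assumes far: "n / (2 * \<beta>) \<le> spread v x"
    and cold: "96 * card (verts G) * \<beta> * exp (2 - \<beta> / 2) \<le> ratio ^ diam"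
  shows "finite_chain.step (arw_states G n) (arw_kernel G n \<beta>) (\<lambda>y. spread v y - spread v x) x
    \<le> - (ratio ^ diam / (8 * \<beta>))"
proof -
  let ?k = "real (card (verts G))" and ?r = "ratio ^ diam" and ?e = "exp (2 - \<beta> / 2)"
  define D where "D i = (\<Sum>j\<in>verts G. pmf (arw_jump G n \<beta> x i) j *
    (potential (vdist v j) - potential (vdist v i)))" for i
  have n0: "0 < real n" and \<beta>0: "0 < \<beta>" using n \<beta> by auto
  have "finite_chain.step (arw_states G n) (arw_kernel G n \<beta>) (\<lambda>y. spread v y - spread v x) x
      = (\<Sum>i\<in>verts G. x i / n * D i)"
    using n unfolding D_def
    by (subst step_arw[OF x])
       (auto intro!: sum.cong simp: spread_move Suc_le_eq)
  also have "\<dots> = x v / n * D v + (\<Sum>i\<in>verts G - {v}. x i / n * D i)"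
    using v by (simp add: sum.remove)
  also have "\<dots> \<le> 1 * (?k * (6 * ?e)) + (\<Sum>i\<in>verts G - {v}. x i / n * - ?r)"
  proof (intro add_mono sum_mono)
    have "x v / n * D v \<le> x v / n * (?k * (6 * ?e))"
      using drift_at_peak unfolding D_def by (intro mult_left_mono) auto
    also have "\<dots> \<le> 1 * (?k * (6 * ?e))"
      using states_le[OF x, of v] n0 by (intro mult_right_mono) auto
    finally show "x v / n * D v \<le> 1 * (?k * (6 * ?e))" .
    show "x i / n * D i \<le> x i / n * - ?r" if "i \<in> verts G - {v}" for i
      using drift_off_peak[of i] that unfolding D_def by (intro mult_left_mono) auto
  qed
  also have "\<dots> = 6 * ?k * ?e - (n - real (x v)) / n * ?r"
  proof -
    have "real n - x v = (\<Sum>i\<in>verts G - {v}. real (x i))"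
      using x v by (simp add: arw_states_def sum.remove[of _ v] flip: of_nat_sum)
    then show ?thesis by (simp add: sum_negf flip: sum_distrib_right sum_divide_distrib)
  qed
  also have "\<dots> \<le> 6 * ?k * ?e - 1 / (4 * \<beta>) * ?r"
  proof -
    have "n / (2 * \<beta>) \<le> 2 * (n - real (x v))" using far spread_bounds(2)[OF x v] by linarith
    then have "1 / (4 * \<beta>) \<le> (n - real (x v)) / n" using n0 \<beta>0 by (simp add: field_simps)
    then show ?thesis using ratio_bounds by (intro diff_left_mono mult_right_mono) auto
  qed
  also have "\<dots> \<le> - (?r / (8 * \<beta>))"
  proof -
    have "6 * ?k * ?e \<le> ?r / (16 * \<beta>)" using cold \<beta>0 by (simp add: field_simps)
    moreover have "0 \<le> ?r / (16 * \<beta>)" using \<beta>0 ratio_bounds by simp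
    moreover have "1 / (4 * \<beta>) * ?r = 4 * (?r / (16 * \<beta>))" "?r / (8 * \<beta>) = 2 * (?r / (16 * \<beta>))"
      by simp_all
    ultimately show ?thesis by linarith
  qed
  finally show ?thesis .
qed

end

definition drift_rate :: "real \<Rightarrow> real" where
  "drift_rate \<beta> = ratio ^ diam / (8 * \<beta>)"

lemma bottleneck_near_vertex:
  fixes \<beta> :: real and n :: nat
  assumes \<beta>: "2 \<le> \<beta>" and v: "v \<in> verts G" and n: "4 * \<beta> \<le> n"
    and cold: "96 * card (verts G) * \<beta> * exp (2 - \<beta> / 2) \<le> ratio ^ diam"
  defines "\<kappa> \<equiv> drift_rate \<beta>"
  shows "bottleneck_ratio (arw_states G n) (arw_kernel G n \<beta>) {x\<in>arw_states G n. spread v x < n / \<beta>}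
    \<le> 16 / \<kappa>\<^sup>2 * exp (- (\<kappa> / 8) * (n / (2 * \<beta>) - 4))"
proof -
  have n2: "2 \<le> n" using n \<beta> by linarith
  interpret chain: ergodic_chain "arw_states G n" "arw_kernel G n \<beta>"
    by (rule ergodic_chain_arw) (use n2 in simp)
  have r: "0 < ratio ^ diam" "ratio ^ diam \<le> 1" using ratio_bounds by (auto intro: power_le_one)
  have \<kappa>: "0 < \<kappa>" "\<kappa> \<le> 1" using r \<beta> by (auto simp: \<kappa>_def drift_rate_def field_simps)
  have "bottleneck_ratio (arw_states G n) (arw_kernel G n \<beta>) {x\<in>arw_states G n. spread v x < n / \<beta>}
    \<le> 2 / (\<kappa> / 8 * \<kappa>) * exp (- (\<kappa> / 8) * (n / \<beta> - n / (2 * \<beta>) - 2 * 2))"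
  proof (rule chain.bottleneck_ratio_drift_le)
    fix x y assume x: "x \<in> arw_states G n" and y: "y \<in> set_pmf (arw_kernel G n \<beta> x)"
    then obtain i j where ij: "1 \<le> x i" "j \<in> insert i (neighbors G i)" "y = move_particle x i j"
      using n2 by (auto simp: arw_kernel_def set_arw_pick set_arw_jump)
    have i: "i \<in> verts G" using ij(1) x by (auto simp: arw_states_def)
    then have "j \<in> verts G" using ij(2) neighbor_in_verts by auto
    then have "spread v y - spread v x = potential (vdist v j) - potential (vdist v i)"
      unfolding ij(3) by (rule spread_move[of x i, OF ij(1) i])
    then show "\<bar>spread v y - spread v x\<bar> \<le> 2"
      using potential_bounds(1,2)[of "vdist v i"] potential_bounds(1,2)[of "vdist v j"] by linarith
  next
    fix x assume "x \<in> arw_states G n" "n / (2 * \<beta>) \<le> spread v x" "spread v x < n / \<beta>"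
    then show "chain.step (\<lambda>y. spread v y - spread v x) x \<le> - \<kappa>"
      unfolding \<kappa>_def drift_rate_def using spread_drift[OF n2 \<beta> v] cold by blast
  next
    show "n / (2 * \<beta>) \<le> n / \<beta> - 2" using n \<beta> by (simp add: field_simps)
  qed (use \<kappa> in auto)
  moreover have "n / \<beta> - n / (2 * \<beta>) - 2 * 2 = n / (2 * \<beta>) - 4" using \<beta> by (simp add: field_simps)
  ultimately show ?thesis by (simp add: power2_eq_square)
qed

lemma small_bottleneck:
  fixes \<beta> :: real and n :: nat
  assumes \<beta>: "2 \<le> \<beta>" and n: "4 * \<beta> \<le> n"
    and cold: "96 * card (verts G) * \<beta> * exp (2 - \<beta> / 2) \<le> ratio ^ diam"
  defines "\<kappa> \<equiv> drift_rate \<beta>" and "\<Phi> \<equiv> bottleneck_ratio (arw_states G n) (arw_kernel G n \<beta>)"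
  obtains S where "S \<subseteq> arw_states G n" "S \<noteq> {}"
    "measure_pmf.prob (stationary_pmf (arw_states G n) (arw_kernel G n \<beta>)) S \<le> 1 / 2"
    "\<Phi> S \<le> 16 / \<kappa>\<^sup>2 * exp (- (\<kappa> / 8) * (n / (2 * \<beta>) - 4))"
proof -
  have n2: "2 \<le> n" using n \<beta> by linarith
  interpret chain: ergodic_chain "arw_states G n" "arw_kernel G n \<beta>"
    by (rule ergodic_chain_arw) (use n2 in simp)
  let ?S = "\<lambda>v. {x\<in>arw_states G n. spread v x < n / \<beta>}"
  obtain v w where vw: "v \<in> verts G" "w \<in> verts G" "v \<noteq> w"
    using card_verts card_le_Suc0_iff_eq[OF finite_verts] by (metis not_less_eq_eq numeral_2_eq_2)
  have ne: "?S u \<noteq> {}" if u: "u \<in> verts G" for u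
  proof -
    let ?c = "\<lambda>i. if i = u then n else 0"
    have c: "?c \<in> arw_states G n" using u by (auto simp: arw_states_def)
    then have "spread u ?c \<le> 0" using spread_bounds(2)[OF c u] by simp
    moreover have "0 < n / \<beta>" using n2 \<beta> by simp
    ultimately have "?c \<in> ?S u" using c by simp
    then show ?thesis by blast
  qed
  \<comment> \<open>A common configuration would have more than half of its particles at
    \<open>w\<close> and fewer than half there.\<close>
  have "?S v \<inter> ?S w = {}"
  proof (rule ccontr)
    assume "?S v \<inter> ?S w \<noteq> {}"
    then obtain x where x: "x \<in> arw_states G n" "spread v x < n / \<beta>" "spread w x < n / \<beta>" by blast
    note v = near_concentrated[OF n2 \<beta> vw(1) x(1,2)] and w = near_concentrated[OF n2 \<beta> vw(2) x(1,3)]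
    show False using v(2)[OF vw(3)[symmetric]] w(1,3) by linarith
  qed
  then obtain u where u: "u \<in> verts G" "measure_pmf.prob chain.\<pi> (?S u) \<le> 1 / 2"
    using chain.disjoint_prob_le_half[of "?S v" "?S w"] vw by auto
  show ?thesis
  proof (rule that[of "?S u"])
    show "\<Phi> (?S u) \<le> 16 / \<kappa>\<^sup>2 * exp (- (\<kappa> / 8) * (n / (2 * \<beta>) - 4))"
      unfolding \<Phi>_def \<kappa>_def by (rule bottleneck_near_vertex[OF \<beta> u(1) n cold])
  qed (use u ne in auto)
qed

lemma slow_mixing:
  fixes \<beta> :: real
  assumes \<beta>: "2 \<le> \<beta>" and cold: "96 * card (verts G) * \<beta> * exp (2 - \<beta> / 2) \<le> ratio ^ diam"
  obtains c where "0 < c" "\<forall>\<^sub>F n in sequentially. exp (c * real n) \<le> arw_mixing_time G n \<beta>"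
    "\<forall>\<^sub>F n in sequentially. arw_cheeger G n \<beta> \<le> exp (- c * real n)"
proof -
  let ?\<kappa> = "drift_rate \<beta>"
  let ?B = "\<lambda>n. 16 / ?\<kappa>\<^sup>2 * exp (- (?\<kappa> / 8) * (n / (2 * \<beta>) - 4))"
  \<comment> \<open>The bottleneck bound decays at rate 2c; one factor exp(-c n) absorbs the
    constants.\<close>
  define c where "c = ?\<kappa> / (32 * \<beta>)"
  have \<kappa>: "0 < ?\<kappa>" using ratio_bounds \<beta> by (simp add: drift_rate_def)
  then have c: "0 < c" using \<beta> by (simp add: c_def)
  have B: "?B n = 16 / ?\<kappa>\<^sup>2 * exp (?\<kappa> / 2) * exp (- 2 * c * n)" for n
    using \<beta> by (simp add: c_def field_simps flip: exp_add)
  have "(\<lambda>n. 4 * (16 / ?\<kappa>\<^sup>2 * exp (?\<kappa> / 2)) * exp (- c * real n)) \<longlonglongrightarrow> 0"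
    using c by real_asymp
  then have "\<forall>\<^sub>F n in sequentially. 4 * (16 / ?\<kappa>\<^sup>2 * exp (?\<kappa> / 2)) * exp (- c * real n) < 1"
    by (rule order_tendstoD) simp
  moreover have "\<forall>\<^sub>F n in sequentially. 4 * \<beta> \<le> real n"
    using eventually_ge_at_top[of "nat \<lceil>4 * \<beta>\<rceil>"] by eventually_elim linarith
  ultimately have ev: "\<forall>\<^sub>F n in sequentially. exp (c * real n) \<le> arw_mixing_time G n \<beta> \<and>
      arw_cheeger G n \<beta> \<le> exp (- c * real n)"
  proof eventually_elim
    fix n assume small: "4 * (16 / ?\<kappa>\<^sup>2 * exp (?\<kappa> / 2)) * exp (- c * real n) < 1" and n: "4 * \<beta> \<le> real n"
    interpret chain: ergodic_chain "arw_states G n" "arw_kernel G n \<beta>"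
      by (rule ergodic_chain_arw) (use n \<beta> in linarith)
    obtain S where S: "S \<subseteq> arw_states G n" "S \<noteq> {}" "measure_pmf.prob chain.\<pi> S \<le> 1 / 2"
      "bottleneck_ratio (arw_states G n) (arw_kernel G n \<beta>) S \<le> ?B n"
      by (rule small_bottleneck[OF \<beta> n cold])
    let ?\<Phi> = "bottleneck_ratio (arw_states G n) (arw_kernel G n \<beta>) S"
    have "4 * ?B n = 4 * (16 / ?\<kappa>\<^sup>2 * exp (?\<kappa> / 2)) * exp (- c * real n) * exp (- c * real n)"
      unfolding B by (simp flip: exp_add)
    also have "\<dots> \<le> 1 * exp (- c * real n)" using small by (intro mult_right_mono) auto
    finally have \<Phi>: "4 * ?\<Phi> \<le> exp (- c * real n)" using S(4) by linarith
    have "1 \<le> real (arw_mixing_time G n \<beta>) * (4 * ?\<Phi>)"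
      using chain.mixing_time_bottleneck[OF S(1-3)] by (simp add: arw_mixing_time_def)
    also have "\<dots> \<le> real (arw_mixing_time G n \<beta>) * exp (- c * real n)"
      using \<Phi> by (intro mult_left_mono) auto
    finally have "exp (c * real n) \<le> real (arw_mixing_time G n \<beta>)"
      by (simp add: exp_minus field_simps)
    moreover have "arw_cheeger G n \<beta> \<le> ?\<Phi>"
      unfolding arw_cheeger_def by (rule chain.cheeger_le[OF S(1-3)])
    then have "arw_cheeger G n \<beta> \<le> exp (- c * real n)"
    proof -
      have "4 * ?\<Phi> \<le> exp (- c * real n)" "0 \<le> exp (- c * real n)" using \<Phi> by auto
      then show ?thesis using \<open>arw_cheeger G n \<beta> \<le> ?\<Phi>\<close> by linarith
    qed
    ultimately show "exp (c * real n) \<le> arw_mixing_time G n \<beta> \<and> arw_cheeger G n \<beta> \<le> exp (- c * real n)" ..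
  qed
  show ?thesis
    by (rule that[OF c]) (use ev in \<open>auto elim: eventually_mono\<close>)
qed

end

section \<open>Assembly of the two regimes\<close>

lemma (in arw) exists_arw_free_walk: "\<exists>T. arw_free_walk G T"
proof -
  interpret walk: ergodic_chain "verts G" "arw_jump G 1 0 (\<lambda>_. 0)" by (rule ergodic_chain_walk)
  obtain T where T: "\<And>g. osc (verts G) ((walk.step ^^ T) g) \<le> 1 / 2 * osc (verts G) g"
    using walk.osc_steps_small[of "1 / 2"] by auto
  \<comment> \<open>One more step does not increase the oscillation and ensures that the contraction
    time is at least 1.\<close>
  have "osc (verts G) ((walk.step ^^ Suc T) g) \<le> osc (verts G) g / 2" for g
    using walk.osc_steps_le[of 1 "(walk.step ^^ T) g"] T[of g] by simp
  then have "arw_free_walk G (Suc T)" by unfold_locales simp_all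
  then show ?thesis by blast
qed

lemma (in arw) card_states_ge_2:
  assumes "1 \<le> n"
  shows "2 \<le> card (arw_states G n)"
proof -
  obtain v w where vw: "v \<in> verts G" "w \<in> verts G" "v \<noteq> w"
    using card_verts card_le_Suc0_iff_eq[OF finite_verts] by (metis not_less_eq_eq numeral_2_eq_2)
  let ?c = "\<lambda>u i. if i = u then n else 0"
  have "?c v \<noteq> ?c w" using vw(3) assms by (auto simp: fun_eq_iff)
  moreover have "{?c v, ?c w} \<subseteq> arw_states G n" using vw by (auto simp: arw_states_def)
  then have "card {?c v, ?c w} \<le> card (arw_states G n)"
    by (intro card_mono finite_arw_states finite_verts)
  ultimately show ?thesis by simp
qed

lemma (in arw_free_walk) fast_mixing:
  assumes \<beta>: "0 \<le> \<beta>" "\<beta> < 1 / (16 * (real T)\<^sup>2)"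
  shows "(\<lambda>n. real (arw_mixing_time G n \<beta>)) \<in> O(\<lambda>n. real n * ln (real n))"
    and "\<exists>c>0. \<forall>\<^sub>F n in sequentially. c / (real n * ln (real n)) \<le> arw_cheeger G n \<beta>"
proof -
  define c where "c = 1 / (2 * real T) - 8 * real T * \<beta>"
  define g where "g n = real n / c * ln (4 * real T * real n) + 1" for n
  have T: "0 < real T" using T_pos by simp
  have "8 * real T * \<beta> < 8 * real T * (1 / (16 * (real T)\<^sup>2))" using \<beta> T by (intro mult_strict_left_mono) auto
  also have "\<dots> = 1 / (2 * real T)" using T by (simp add: power2_eq_square)
  finally have c: "0 < c" by (simp add: c_def)
  have "(\<lambda>n. g n) \<in> O(\<lambda>n. real n * ln (real n))" unfolding g_def using c T by real_asymp
  then obtain C where C: "0 < C" "\<forall>\<^sub>F n in sequentially. norm (g n) \<le> C * norm (real n * ln (real n))"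
    by (rule landau_o.bigE)
  have ev: "\<forall>\<^sub>F n in sequentially. real (arw_mixing_time G n \<beta>) \<le> C * (real n * ln (real n)) \<and> 2 \<le> n"
    using C(2) eventually_ge_at_top[of 2]
  proof eventually_elim
    fix n :: nat assume g: "norm (g n) \<le> C * norm (real n * ln (real n))" and n: "2 \<le> n"
    have "real (arw_mixing_time G n \<beta>) \<le> g n"
      unfolding g_def c_def by (rule arw_mixing_time_le[OF \<beta>]) (use n in simp)
    moreover have "0 \<le> real n * ln (real n)" using n by simp
    ultimately show "real (arw_mixing_time G n \<beta>) \<le> C * (real n * ln (real n)) \<and> 2 \<le> n"
      using g n by simp
  qed
  show "(\<lambda>n. real (arw_mixing_time G n \<beta>)) \<in> O(\<lambda>n. real n * ln (real n))"
    using ev by (intro bigoI[of _ C]) (auto elim!: eventually_mono)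
  have "\<forall>\<^sub>F n in sequentially. 1 / (4 * C) / (real n * ln (real n)) \<le> arw_cheeger G n \<beta>"
    using ev
  proof eventually_elim
    fix n :: nat assume n: "real (arw_mixing_time G n \<beta>) \<le> C * (real n * ln (real n)) \<and> 2 \<le> n"
    interpret chain: ergodic_chain "arw_states G n" "arw_kernel G n \<beta>"
      by (rule ergodic_chain_arw) (use n in simp)
    let ?t = "real (arw_mixing_time G n \<beta>)" and ?\<Phi> = "arw_cheeger G n \<beta>"
    have nln: "0 < real n * ln (real n)" using n by simp
    have t\<Phi>: "1 / 4 \<le> ?t * ?\<Phi>"
      unfolding arw_mixing_time_def arw_cheeger_def
      by (rule chain.mixing_time_cheeger[OF card_states_ge_2]) (use n in simp)
    \<comment> \<open>Positivity of the Cheeger constant is required before the upper bound on the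
      mixing time can be multiplied by it.\<close>
    then have "0 < ?t * ?\<Phi>" by linarith
    then have "0 < ?\<Phi>" by (auto simp: zero_less_mult_iff)
    then have "?t * ?\<Phi> \<le> C * (real n * ln (real n)) * ?\<Phi>" using n by (intro mult_right_mono) auto
    with t\<Phi> have "1 / 4 \<le> C * (real n * ln (real n)) * ?\<Phi>" by linarith
    then show "1 / (4 * C) / (real n * ln (real n)) \<le> ?\<Phi>"
      using nln C(1) by (simp add: field_simps)
  qed
  then show "\<exists>c>0. \<forall>\<^sub>F n in sequentially. c / (real n * ln (real n)) \<le> arw_cheeger G n \<beta>"
    using C(1) by (intro exI[of _ "1 / (4 * C)"]) auto
qed

theorem corollary1:
  fixes G :: "('a, 'b) pre_digraph"
  assumes "graph G" and "Digraph_Component.connected G" and "card (verts G) \<ge> 2"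
  shows "\<exists>\<beta>\<^sub>p>0. \<exists>\<beta>\<^sub>m>0.
    (\<forall>\<beta>>\<beta>\<^sub>p.
       (\<exists>c>0. \<exists>n\<^sub>0. \<forall>n\<ge>n\<^sub>0. real (arw_mixing_time G n \<beta>) \<ge> exp (c * real n)) \<and>
       (\<exists>c>0. \<exists>n\<^sub>0. \<forall>n\<ge>n\<^sub>0. arw_cheeger G n \<beta> \<le> exp (- c * real n))) \<and>
    (\<forall>\<beta>. 0 \<le> \<beta> \<and> \<beta> < \<beta>\<^sub>m \<longrightarrow>
       (\<lambda>n. real (arw_mixing_time G n \<beta>)) \<in> O(\<lambda>n. real n * ln (real n)) \<and>
       (\<exists>c>0. \<exists>n\<^sub>0. \<forall>n\<ge>n\<^sub>0. arw_cheeger G n \<beta> \<ge> c / (real n * ln (real n))))"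
proof -
  interpret arw G by (intro arw.intro arw_axioms.intro assms)
  \<comment> \<open>Exponential decay beats the linear factor, so the cold condition holds for all
    large \<beta>, with a threshold determined by the graph.\<close>
  have "((\<lambda>\<beta>::real. 96 * real (card (verts G)) * \<beta> * exp (2 - \<beta> / 2)) \<longlongrightarrow> 0) at_top"
    using card_verts by real_asymp
  then have "\<forall>\<^sub>F \<beta> in at_top. 96 * real (card (verts G)) * \<beta> * exp (2 - \<beta> / 2) < ratio ^ diam"
    using ratio_bounds by (intro order_tendstoD) auto
  then obtain B where B: "\<And>\<beta>. B \<le> \<beta> \<Longrightarrow> 96 * real (card (verts G)) * \<beta> * exp (2 - \<beta> / 2) < ratio ^ diam"
    unfolding eventually_at_top_linorder by blast
  \<comment> \<open>The free walk has \<beta> = 0, so \<open>T\<close>, and with it the threshold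
    1/(16 T^2), depends only on the graph.\<close>
  obtain T where "arw_free_walk G T" using exists_arw_free_walk by blast
  then interpret arw_free_walk G T .
  show ?thesis
  proof (rule exI[of _ "max 2 B"], intro conjI, simp, rule exI[of _ "1 / (16 * (real T)\<^sup>2)"],
      intro conjI allI impI)
    show "0 < 1 / (16 * (real T)\<^sup>2)" using T_pos by simp
    fix \<beta> :: real assume \<beta>: "max 2 B < \<beta>"
    have "2 \<le> \<beta>" "96 * card (verts G) * \<beta> * exp (2 - \<beta> / 2) \<le> ratio ^ diam"
      using \<beta> B[of \<beta>] by auto
    from slow_mixing[OF this] show
      "\<exists>c>0. \<exists>n\<^sub>0. \<forall>n\<ge>n\<^sub>0. real (arw_mixing_time G n \<beta>) \<ge> exp (c * real n)"
      "\<exists>c>0. \<exists>n\<^sub>0. \<forall>n\<ge>n\<^sub>0. arw_cheeger G n \<beta> \<le> exp (- c * real n)"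
      unfolding eventually_sequentially by metis+
  next
    fix \<beta> :: real assume \<beta>: "0 \<le> \<beta> \<and> \<beta> < 1 / (16 * (real T)\<^sup>2)"
    note fast = fast_mixing[OF conjunct1[OF \<beta>] conjunct2[OF \<beta>]]
    show "(\<lambda>n. real (arw_mixing_time G n \<beta>)) \<in> O(\<lambda>n. real n * ln (real n))" by (rule fast(1))
    show "\<exists>c>0. \<exists>n\<^sub>0. \<forall>n\<ge>n\<^sub>0. arw_cheeger G n \<beta> \<ge> c / (real n * ln (real n))"
      using fast(2) unfolding eventually_sequentially .
  qed
qed

end
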